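(* The signed generalized Wasserstein distance $\mathbb{W}_1^{1,1}$ coincides with the bounded Lipschitz distance: for all $\mu,\nu\in\mathcal{M}^s(\mathbb{R}^d)$, $$\mathbb{W}_1^{1,1}(\mu,\nu)=\sup\left\{\int_{\mathbb{R}^d}\varphi\,d(\mu-\nu)\;:\;\varphi\in C_b^{0,Lip}(\mathbb{R}^d),\ \|\varphi\|_\infty\le1,\ \|\varphi\|_{Lip}\le1\right\}.$$
   Context: $\mathcal{M}(\mathbb{R}^d)$ is the set of positive Borel (Radon) measures on $\mathbb{R}^d$ with finite mass; $\mathcal{M}^s(\mathbb{R}^d)$ is the vector space of signed measures $\mu=\mu_+-\mu_-$ with $\mu_\pm\in\mathcal{M}(\mathbb{R}^d)$; $|\mu|$ denotes the total mass (total variation) of $\mu$. For $\tilde\mu,\tilde\nu\in\mathcal{M}(\mathbb{R}^d)$ of equal mass, $W_1(\tilde\mu,\tilde\nu)=\min_{\pi}\int|x-y|\,d\pi(x,y)$ over positive measures $\pi$ on $\mathbb{R}^d\times\mathbb{R}^d$ with marginals $\tilde\mu,\tilde\nu$. For $a,b>0$ and $\mu,\nu\in\mathcal{M}(\mathbb{R}^d)$, $$W_1^{a,b}(\mu,\nu)=\inf\{a(|\mu-\tilde\mu|+|\nu-\tilde\nu|)+bW_1(\tilde\mu,\tilde\nu):\ \tilde\mu,\tilde\nu\in\mathcal{M}(\mathbb{R}^d),\ |\tilde\mu|=|\tilde\nu|\}.$$ For $\mu,\nu\in\mathcal{M}^s(\mathbb{R}^d)$, $\mathbb{W}_1^{a,b}(\mu,\nu)=W_1^{a,b}(\mu_++\nu_-,\mu_-+\nu_+)$,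 where $\mu=\mu_+-\mu_-$ and $\nu=\nu_+-\nu_-$ are any decompositions with $\mu_\pm,\nu_\pm\in\mathcal{M}(\mathbb{R}^d)$ (the value does not depend on the decompositions). $\|f\|_\infty=\sup_x|f(x)|$, $\|f\|_{Lip}=\sup_{x\ne y}|f(x)-f(y)|/|x-y|$, and $C_b^{0,Lip}(\mathbb{R}^d)$ is the set of bounded continuous functions $f:\mathbb{R}^d\to\mathbb{R}$ with $\|f\|_{Lip}<\infty$. *)

theory Defs
  imports "HOL-Analysis.Analysis"
begin

section \<open>Finite and signed Borel measures\<close>

text \<open>On a Euclidean space every finite Borel measure is Radon, so regularity is not
  stated separately.\<close>

definition finite_borel_measures :: "'a::euclidean_space measure set" where
  "finite_borel_measures = {M. finite_measure M \<and> sets M = sets borel}"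

definition add_measure :: "'a measure \<Rightarrow> 'a measure \<Rightarrow> 'a measure" where
  "add_measure M N = measure_of (space M) (sets M) (\<lambda>A. emeasure M A + emeasure N A)"

text \<open>A signed measure is represented by its set function. As \<^const>\<open>measure\<close> vanishes on
  sets that are not measurable, so does every signed measure, and two signed measures are
  equal as functions iff they agree on Borel sets. The difference of signed measures is the
  pointwise difference.\<close>

definition is_decomposition ::
    "('a::euclidean_space set \<Rightarrow> real) \<Rightarrow> 'a measure \<Rightarrow> 'a measure \<Rightarrow> bool" where
  "is_decomposition \<sigma> P N \<longleftrightarrow> P \<in> finite_borel_measures \<and> N \<in> finite_borel_measures \<and>
     \<sigma> = (\<lambda>A. measure P A - measure N A)"

definition signed_measures :: "('a::euclidean_space set \<Rightarrow> real) set" where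
  "signed_measures = {\<sigma>. \<exists>P N. is_decomposition \<sigma> P N}"

definition total_variation :: "('a::euclidean_space set \<Rightarrow> real) \<Rightarrow> ennreal" where
  "total_variation \<sigma> =
     (SUP \<A>\<in>{\<A>. finite \<A> \<and> \<A> \<subseteq> sets borel \<and> partition_on UNIV \<A>}. \<Sum>A\<in>\<A>. ennreal \<bar>\<sigma> A\<bar>)"

text \<open>The value is the same for every decomposition if \<^term>\<open>f\<close> is bounded and Borel
  measurable; see \<open>signed_integral_eq\<close> below.\<close>

definition signed_integral :: "('a::euclidean_space set \<Rightarrow> real) \<Rightarrow> ('a \<Rightarrow> real) \<Rightarrow> real" where
  "signed_integral \<sigma> f = (THE r. \<exists>P N. is_decomposition \<sigma> P N \<and>
     r = (\<integral>x. f x \<partial>P) - (\<integral>x. f x \<partial>N))"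


section \<open>Generalized Wasserstein distances\<close>

definition couplings ::
    "'a::euclidean_space measure \<Rightarrow> 'a measure \<Rightarrow> ('a \<times> 'a) measure set" where
  "couplings M N = {\<pi>. sets \<pi> = sets (borel \<Otimes>\<^sub>M borel) \<and>
     distr \<pi> borel fst = M \<and> distr \<pi> borel snd = N}"

text \<open>First moments need not be finite, so the cost may be infinite, also for measures of
  equal mass; hence the value is an extended real.\<close>

definition wasserstein1 :: "'a::euclidean_space measure \<Rightarrow> 'a measure \<Rightarrow> ennreal" where
  "wasserstein1 M N = (INF \<pi>\<in>couplings M N. \<integral>\<^sup>+(x, y). ennreal (dist x y) \<partial>\<pi>)"

definition gen_wasserstein ::
    "real \<Rightarrow> real \<Rightarrow> 'a::euclidean_space measure \<Rightarrow> 'a measure \<Rightarrow> ennreal" where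
  "gen_wasserstein a b M N =
     (INF (M', N')\<in>{(M', N'). M' \<in> finite_borel_measures \<and> N' \<in> finite_borel_measures \<and>
                              measure M' UNIV = measure N' UNIV}.
        ennreal a * (total_variation (\<lambda>A. measure M A - measure M' A) +
                     total_variation (\<lambda>A. measure N A - measure N' A)) +
        ennreal b * wasserstein1 M' N')"

text \<open>The common value over all decompositions of the two arguments.\<close>

definition signed_gen_wasserstein ::
    "real \<Rightarrow> real \<Rightarrow> ('a::euclidean_space set \<Rightarrow> real) \<Rightarrow> ('a set \<Rightarrow> real) \<Rightarrow> ennreal" where
  "signed_gen_wasserstein a b \<mu> \<nu> = (THE r. \<exists>\<mu>p \<mu>n \<nu>p \<nu>n.
     is_decomposition \<mu> \<mu>p \<mu>n \<and> is_decomposition \<nu> \<nu>p \<nu>n \<and>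
     r = gen_wasserstein a b (add_measure \<mu>p \<nu>n) (add_measure \<mu>n \<nu>p))"


section \<open>Bounded Lipschitz functions\<close>

definition sup_norm :: "('a \<Rightarrow> real) \<Rightarrow> ennreal" where
  "sup_norm f = (SUP x. ennreal \<bar>f x\<bar>)"

definition lip_norm :: "('a::metric_space \<Rightarrow> real) \<Rightarrow> ennreal" where
  "lip_norm f = (SUP (x, y)\<in>{(x, y). x \<noteq> y}. ennreal (\<bar>f x - f y\<bar> / dist x y))"

definition bounded_lipschitz_functions :: "('a::metric_space \<Rightarrow> real) set" where
  "bounded_lipschitz_functions = {f. bounded (range f) \<and> continuous_on UNIV f \<and> lip_norm f < \<infinity>}"


section \<open>Basic facts\<close>

lemma sets_add_measure [simp, measurable_cong]: "sets (add_measure M N) = sets M"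
  and space_add_measure [simp]: "space (add_measure M N) = space M"
  by (simp_all add: add_measure_def)

lemma emeasure_add_measure:
  assumes "sets N = sets M" "A \<in> sets M"
  shows "emeasure (add_measure M N) A = emeasure M A + emeasure N A"
proof (rule emeasure_measure_of[OF add_measure_def])
  show "countably_additive (sets (add_measure M N)) (\<lambda>A. emeasure M A + emeasure N A)"
    using assms(1)
    by (auto simp: countably_additive_def suminf_add[symmetric] suminf_emeasure)
qed (use assms in \<open>auto simp: positive_def dest: sets.sets_into_space\<close>)

lemma nn_integral_add_measure:
  assumes "sets N = sets M" "f \<in> borel_measurable M"
  shows "(\<integral>\<^sup>+x. f x \<partial>add_measure M N) = (\<integral>\<^sup>+x. f x \<partial>M) + (\<integral>\<^sup>+x. f x \<partial>N)"
proof -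
  have [measurable_cong]: "sets N = sets M" by fact
  have sp: "space N = space M" by (rule sets_eq_imp_space_eq) fact
  show ?thesis
    using assms(2)
  proof (induction rule: borel_measurable_induct)
    case (cong f g)
    then have "(\<integral>\<^sup>+x. f x \<partial>K) = (\<integral>\<^sup>+x. g x \<partial>K)" if "space K = space M" for K
      using that by (intro nn_integral_cong) auto
    then show ?case using cong sp by simp
  next
    case (set A)
    then show ?case using assms(1) by (simp add: emeasure_add_measure)
  next
    case (mult u c)
    then show ?case by (simp add: nn_integral_cmult distrib_left)
  next
    case (add u v)
    then show ?case by (simp add: nn_integral_add algebra_simps)
  next
    case (seq U)
    note [measurable] = seq(1)
    have "(\<integral>\<^sup>+x. (SUP i. U i x) \<partial>add_measure M N) = (SUP i. \<integral>\<^sup>+x. U i x \<partial>add_measure M N)"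
      using seq by (intro nn_integral_monotone_convergence_SUP) auto
    also have "\<dots> = (SUP i. (\<integral>\<^sup>+x. U i x \<partial>M) + (\<integral>\<^sup>+x. U i x \<partial>N))"
      using seq by simp
    also have "\<dots> = (SUP i. \<integral>\<^sup>+x. U i x \<partial>M) + (SUP i. \<integral>\<^sup>+x. U i x \<partial>N)"
      using seq(3)
      by (intro ennreal_SUP_add incseq_SucI nn_integral_mono) (auto simp: incseq_Suc_iff le_fun_def)
    also have "\<dots> = (\<integral>\<^sup>+x. (SUP i. U i x) \<partial>M) + (\<integral>\<^sup>+x. (SUP i. U i x) \<partial>N)"
      using seq by (simp add: nn_integral_monotone_convergence_SUP)
    finally show ?case by (simp add: image_comp SUP_apply)
  qed
qed

lemma integral_add_measure:
  fixes f :: "'a \<Rightarrow> real"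
  assumes "sets N = sets M" "integrable M f" "integrable N f"
  shows "(\<integral>x. f x \<partial>add_measure M N) = (\<integral>x. f x \<partial>M) + (\<integral>x. f x \<partial>N)"
proof -
  have [measurable]: "f \<in> borel_measurable M" using assms by auto
  have nn: "(\<integral>\<^sup>+x. ennreal (g x) \<partial>add_measure M N) = (\<integral>\<^sup>+x. ennreal (g x) \<partial>M) + (\<integral>\<^sup>+x. ennreal (g x) \<partial>N)"
    if "g \<in> borel_measurable M" for g :: "'a \<Rightarrow> real"
    using that assms(1) by (intro nn_integral_add_measure) auto
  have int: "integrable (add_measure M N) f"
    using assms by (auto simp: integrable_iff_bounded nn)
  show ?thesis
    using assms(2,3) int
    by (subst (1 2 3) real_lebesgue_integral_def)
      (auto simp: nn enn2real_plus real_integrable_def less_top)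
qed

lemma signed_integral_eq:
  assumes "is_decomposition \<sigma> P N" "f \<in> borel_measurable borel" "bounded (range f)"
  shows "signed_integral \<sigma> f = (\<integral>x. f x \<partial>P) - (\<integral>x. f x \<partial>N)"
  unfolding signed_integral_def
proof (rule the_equality)
  fix r
  assume "\<exists>P' N'. is_decomposition \<sigma> P' N' \<and> r = (\<integral>x. f x \<partial>P') - (\<integral>x. f x \<partial>N')"
  then obtain P' N' where d': "is_decomposition \<sigma> P' N'"
    and r: "r = (\<integral>x. f x \<partial>P') - (\<integral>x. f x \<partial>N')" by blast
  from assms(3) obtain B where B: "\<bar>f x\<bar> \<le> B" for x
    by (auto simp: bounded_iff)
  have s: "sets P = sets borel" "sets N = sets borel" "sets P' = sets borel" "sets N' = sets borel"
    and fin: "finite_measure P" "finite_measure N" "finite_measure P'" "finite_measure N'"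
    and eq: "(\<lambda>A. measure P A - measure N A) = (\<lambda>A. measure P' A - measure N' A)"
    using assms(1) d' by (auto simp: is_decomposition_def finite_borel_measures_def)
  have int: "integrable K f" if "finite_measure K" "sets K = sets borel" for K
  proof (rule finite_measure.integrable_const_bound[OF that(1)])
    show "AE x in K. norm (f x) \<le> B" using B by simp
    show "f \<in> borel_measurable K" using assms(2) that(2) measurable_cong_sets by blast
  qed
  have "add_measure P N' = add_measure P' N"
  proof (rule measure_eqI)
    fix A assume "A \<in> sets (add_measure P N')"
    moreover have "measure P A + measure N' A = measure P' A + measure N A"
      using fun_cong[OF eq, of A] by linarith
    ultimately show "emeasure (add_measure P N') A = emeasure (add_measure P' N) A"
      using s fin
      by (simp add: emeasure_add_measure finite_measure.emeasure_eq_measure flip: ennreal_plus)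
  qed (simp add: s)
  then have "(\<integral>x. f x \<partial>P) + (\<integral>x. f x \<partial>N') = (\<integral>x. f x \<partial>P') + (\<integral>x. f x \<partial>N)"
    using integral_add_measure[of N' P f] integral_add_measure[of N P' f] s fin int by simp
  then show "r = (\<integral>x. f x \<partial>P) - (\<integral>x. f x \<partial>N)" using r by linarith
qed (use assms(1) in blast)

end

theory Submission
  imports Defs
begin

text \<open>
  With \<open>M = \<mu>\<^sub>+ + \<nu>\<^sub>-\<close> and \<open>N = \<mu>\<^sub>- + \<nu>\<^sub>+\<close> the claim is a duality for two finite positive measures.
  A test function \<open>\<phi>\<close> with \<open>\<bar>\<phi>\<bar> \<le> 1\<close> costs at most the total variation when \<open>M\<close> is replaced by \<open>M'\<close> and
  \<open>N\<close> by \<open>N'\<close>, and, being 1-Lipschitz, at most the transport cost between \<open>M'\<close> and \<open>N'\<close>.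
  Conversely, cut the space into finitely many cells \<open>A\<^sub>i\<close> of diameter of order \<open>e\<close>, up to a set of mass \<open>e\<close>.
  Partial transport between the cell masses is a finite linear program. A dual solution \<open>(f, g)\<close>
  gives the test function \<open>h y = min 1 (min\<^sub>j (g\<^sub>j + dist y x\<^sub>j))\<close>, which lies above \<open>f\<close> and below \<open>g\<close> at the centres;
  a primal solution \<open>t\<close> gives a measure on the product, equal to a multiple of \<open>M \<otimes> N\<close> on each
  \<open>A\<^sub>i \<times> A\<^sub>j\<close>, whose marginals serve as \<open>M' \<le> M\<close> and \<open>N' \<le> N\<close>. No gluing of couplings is needed.
\<close>

section \<open>Finite linear programming duality\<close>

text \<open>The proof is Bartl's induction on the number of constraints: if the constraints in \<open>J\<close> alone do not
  suffice, a violating direction \<open>z\<close> with \<open>A k z = 1\<close> is projected out.\<close>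

lemma farkas:
  fixes A :: "'j \<Rightarrow> 'i \<Rightarrow> real"
  assumes "finite J" and "finite I"
    and "\<And>x. (\<And>j. j \<in> J \<Longrightarrow> (\<Sum>i\<in>I. A j i * x i) \<le> 0) \<Longrightarrow> (\<Sum>i\<in>I. b i * x i) \<le> 0"
  shows "\<exists>l. (\<forall>j\<in>J. 0 \<le> l j) \<and> (\<forall>i\<in>I. b i = (\<Sum>j\<in>J. l j * A j i))"
  using assms(1,3)
proof (induction J arbitrary: A b rule: finite_induct)
  case empty
  \<comment> \<open>Without constraints the direction \<open>x = b\<close> is admissible, so the sum
    of squares is at most 0.\<close>
  then have "(\<Sum>i\<in>I. b i * b i) = 0"
    by (intro antisym sum_nonneg) auto
  then show ?case
    using \<open>finite I\<close> by (subst (asm) sum_nonneg_eq_0_iff) auto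
next
  case (insert k J)
  define L where "L a x = (\<Sum>i\<in>I. a i * x i)" for a x :: "'i \<Rightarrow> real"
  have L_left: "L (\<lambda>i. a i - c * a' i) x = L a x - c * L a' x"
    and L_right: "L a (\<lambda>i. x i - c * x' i) = L a x - c * L a x'" for a a' x x' c
    by (simp_all add: L_def algebra_simps sum_subtractf sum_distrib_left)
  show ?case
  proof (cases "\<forall>x. (\<forall>j\<in>J. L (A j) x \<le> 0) \<longrightarrow> L b x \<le> 0")
    case True
    then obtain l where l: "\<forall>j\<in>J. 0 \<le> l j" "\<forall>i\<in>I. b i = (\<Sum>j\<in>J. l j * A j i)"
      using insert.IH[of A b] by (auto simp: L_def)
    have "(\<Sum>j\<in>insert k J. (l(k := 0)) j * A j i) = (\<Sum>j\<in>J. l j * A j i)" for i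
      using insert.hyps by (auto intro!: sum.cong)
    then show ?thesis
      using l by (intro exI[of _ "l(k := 0)"]) auto
  next
    case False
    then obtain y where y: "\<And>j. j \<in> J \<Longrightarrow> L (A j) y \<le> 0" "L b y > 0"
      by (auto simp: not_le)
    \<comment> \<open>Otherwise \<open>y\<close> would satisfy the constraint \<open>k\<close> as
      well, and the premise would give \<open>L b y \<le> 0\<close>.\<close>
    have "L (A k) y > 0"
      using insert.prems[of y] y by (fastforce simp: L_def not_le[symmetric])
    define z where "z i = y i / L (A k) y" for i
    have L_z: "L a z = L a y / L (A k) y" for a
      by (simp add: L_def z_def sum_divide_distrib)
    have z: "L (A j) z \<le> 0" if "j \<in> J" for j
      using y(1)[OF that] \<open>L (A k) y > 0\<close> by (simp add: L_z divide_le_0_iff)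
    have z_b: "L b z > 0" and z_k: "L (A k) z = 1"
      using y(2) \<open>L (A k) y > 0\<close> by (simp_all add: L_z)
    have "L (\<lambda>i. b i - L b z * A k i) x \<le> 0"
      if "\<And>j. j \<in> J \<Longrightarrow> L (\<lambda>i. A j i - L (A j) z * A k i) x \<le> 0" for x
    proof -
      \<comment> \<open>Subtracting this multiple of \<open>z\<close> makes the constraint
        \<open>k\<close> an equality, while the other constraints become the projected ones.\<close>
      have "L b (\<lambda>i. x i - L (A k) x * z i) \<le> 0"
        unfolding L_def[of b]
      proof (rule insert.prems)
        fix j assume "j \<in> insert k J"
        then show "(\<Sum>i\<in>I. A j i * (x i - L (A k) x * z i)) \<le> 0"
          unfolding L_def[symmetric] L_right using that[unfolded L_left] z_k
          by (auto simp: mult.commute)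
      qed
      then show ?thesis unfolding L_left L_right by (simp add: mult.commute)
    qed
    then obtain l where l: "\<forall>j\<in>J. 0 \<le> l j"
      "\<forall>i\<in>I. b i - L b z * A k i = (\<Sum>j\<in>J. l j * (A j i - L (A j) z * A k i))"
      using insert.IH[of "\<lambda>j i. A j i - L (A j) z * A k i" "\<lambda>i. b i - L b z * A k i"]
      by (auto simp: L_def)
    \<comment> \<open>All multiples of \<open>A k\<close> collected from the projected identity. The
      sum is nonpositive because \<open>z\<close> satisfies the constraints in
      \<open>J\<close>.\<close>
    define c where "c = L b z - (\<Sum>j\<in>J. l j * L (A j) z)"
    have "0 \<le> c"
      using l(1) z z_b sum_nonpos[of J "\<lambda>j. l j * L (A j) z"]
      by (fastforce simp: c_def mult_nonneg_nonpos)
    have "b i = (\<Sum>j\<in>insert k J. (l(k := c)) j * A j i)" if "i \<in> I" for i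
    proof -
      have "(\<Sum>j\<in>insert k J. (l(k := c)) j * A j i) = c * A k i + (\<Sum>j\<in>J. l j * A j i)"
        using insert.hyps by (auto intro!: sum.cong)
      also have "\<dots> = b i"
        using l(2) that
        by (simp add: c_def algebra_simps sum_subtractf sum_distrib_left)
      finally show ?thesis by simp
    qed
    then show ?thesis
      using l(1) \<open>0 \<le> c\<close> by (intro exI[of _ "l(k := c)"]) auto
  qed
qed

text \<open>This is strong duality in the form of a bound: if no admissible pair of potentials
  exceeds \<open>D\<close>, some plan costs at most \<open>D\<close>. Here \<open>u\<close> and
  \<open>v\<close> are the masses left untransported, paid at unit price; \<open>f i \<le> 1\<close>
  and \<open>- 1 \<le> g j\<close> are the dual constraints belonging to them.\<close>

lemma partial_transport_duality:
  fixes m n :: "'k \<Rightarrow> real" and d :: "'k \<Rightarrow> 'k \<Rightarrow> real"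
  assumes "finite K" and nonneg: "\<And>i. i \<in> K \<Longrightarrow> 0 \<le> m i" "\<And>i. i \<in> K \<Longrightarrow> 0 \<le> n i"
    and bound: "\<And>f g. (\<And>i. i \<in> K \<Longrightarrow> f i \<le> 1) \<Longrightarrow> (\<And>j. j \<in> K \<Longrightarrow> - 1 \<le> g j) \<Longrightarrow>
      (\<And>i j. i \<in> K \<Longrightarrow> j \<in> K \<Longrightarrow> f i - g j \<le> d i j) \<Longrightarrow>
      (\<Sum>i\<in>K. m i * f i) - (\<Sum>j\<in>K. n j * g j) \<le> D"
  obtains t u v where
    "\<And>i j. i \<in> K \<Longrightarrow> j \<in> K \<Longrightarrow> 0 \<le> t i j" "\<And>i. i \<in> K \<Longrightarrow> 0 \<le> u i" "\<And>j. j \<in> K \<Longrightarrow> 0 \<le> v j"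
    "\<And>i. i \<in> K \<Longrightarrow> m i = u i + (\<Sum>j\<in>K. t i j)" "\<And>j. j \<in> K \<Longrightarrow> n j = v j + (\<Sum>i\<in>K. t i j)"
    "(\<Sum>i\<in>K. u i) + (\<Sum>j\<in>K. v j) + (\<Sum>i\<in>K. \<Sum>j\<in>K. t i j * d i j) \<le> D"
proof -
  \<comment> \<open>The unknowns are \<open>f\<close>, \<open>g\<close> and a scalar \<open>s\<close> that homogenizes the constraints on \<open>f\<close> and \<open>g\<close>.\<close>
  define I :: "(('k + 'k) + unit) set" where "I = (K <+> K) <+> {()}"
  define J :: "(('k + 'k) + (('k \<times> 'k) + unit)) set" where "J = (K <+> K) <+> (K \<times> K <+> {()})"
  \<comment> \<open>The rows encode, in this order, \<open>f i \<le> s\<close>,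
    \<open>- s \<le> g j\<close>, \<open>f i - g j \<le> d i j * s\<close> and
    \<open>0 \<le> s\<close>.\<close>
  define A :: "('k + 'k) + (('k \<times> 'k) + unit) \<Rightarrow> ('k + 'k) + unit \<Rightarrow> real" where
    "A = case_sum
       (case_sum (\<lambda>i. case_sum (case_sum (\<lambda>k. of_bool (k = i)) (\<lambda>k. 0)) (\<lambda>_. - 1))
                 (\<lambda>j. case_sum (case_sum (\<lambda>k. 0) (\<lambda>k. - of_bool (k = j))) (\<lambda>_. - 1)))
       (case_sum (\<lambda>(i, j). case_sum (case_sum (\<lambda>k. of_bool (k = i)) (\<lambda>k. - of_bool (k = j))) (\<lambda>_. - d i j))
                 (\<lambda>_. case_sum (\<lambda>_. 0) (\<lambda>_. - 1)))"
  define b :: "('k + 'k) + unit \<Rightarrow> real" where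
    "b = case_sum (case_sum m (\<lambda>j. - n j)) (\<lambda>_. - D)"
  note [simp] = \<open>finite K\<close>
  have of_bool: "of_bool P * x = (if P then x else 0)" "x * of_bool P = (if P then x else 0)" for P and x :: real
    by auto
  have sum_pairs: "sum F (K \<times> K) = (\<Sum>i\<in>K. \<Sum>j\<in>K. F (i, j))" for F :: "'k \<times> 'k \<Rightarrow> real"
    by (simp add: sum.cartesian_product)
  have J_intro: "Inl (Inl i) \<in> J" "Inl (Inr i) \<in> J" if "i \<in> K" for i
    using that by (auto simp: J_def)
  have J_intro': "Inr (Inl (i, j)) \<in> J" if "i \<in> K" "j \<in> K" for i j
    using that by (auto simp: J_def)
  have J_intro'': "Inr (Inr ()) \<in> J"
    by (auto simp: J_def)
  note J_intro = J_intro J_intro' J_intro''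
  have I_intro: "Inl (Inl i) \<in> I" "Inl (Inr i) \<in> I" if "i \<in> K" for i
    using that by (auto simp: I_def)
  have I_intro': "Inr () \<in> I"
    by (auto simp: I_def)
  note I_intro = I_intro I_intro'
  have "\<exists>l. (\<forall>j\<in>J. 0 \<le> l j) \<and> (\<forall>i\<in>I. b i = (\<Sum>j\<in>J. l j * A j i))"
  proof (rule farkas)
    fix x assume x: "(\<Sum>i\<in>I. A j i * x i) \<le> 0" if "j \<in> J" for j
    define f where "f i = x (Inl (Inl i))" for i
    define g where "g j = x (Inl (Inr j))" for j
    define s where "s = x (Inr ())"
    have f: "f i \<le> s" if "i \<in> K" for i
      using x[of "Inl (Inl i)"] that
      by (simp add: J_intro I_def A_def sum.Plus f_def s_def of_bool)
    have g: "- s \<le> g j" if "j \<in> K" for j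
      using x[of "Inl (Inr j)"] that
      by (simp add: J_intro I_def A_def sum.Plus g_def s_def of_bool sum_negf)
    have fg: "f i - g j \<le> d i j * s" if "i \<in> K" "j \<in> K" for i j
      using x[of "Inr (Inl (i, j))"] that
      by (simp add: J_intro I_def A_def sum.Plus f_def g_def s_def of_bool sum_negf)
    have "0 \<le> s"
      using x[of "Inr (Inr ())"] by (simp add: J_intro I_def A_def sum.Plus s_def)
    have "(\<Sum>i\<in>K. m i * f i) - (\<Sum>j\<in>K. n j * g j) \<le> D * s"
    \<comment> \<open>For \<open>s > 0\<close>, division by \<open>s\<close> gives a pair to which
      \<open>bound\<close> applies. For \<open>s = 0\<close> the constraints force
      \<open>f \<le> 0 \<le> g\<close> on \<open>K\<close>, and the nonnegativity of the masses
      decides the sign.\<close>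
    proof (cases "s = 0")
      case True
      then have "(\<Sum>i\<in>K. m i * f i) \<le> 0" "(\<Sum>j\<in>K. n j * g j) \<ge> 0"
        using f g nonneg by (auto intro!: sum_nonpos sum_nonneg mult_nonneg_nonpos)
      with True show ?thesis by simp
    next
      case False
      then have "s > 0" using \<open>0 \<le> s\<close> by simp
      have "(\<Sum>i\<in>K. m i * (f i / s)) - (\<Sum>j\<in>K. n j * (g j / s)) \<le> D"
        using \<open>s > 0\<close> f g fg
        by (intro bound) (auto simp: field_simps simp flip: diff_divide_distrib)
      then show ?thesis
        using \<open>s > 0\<close> by (simp add: field_simps flip: sum_divide_distrib)
    qed
    then show "(\<Sum>i\<in>I. b i * x i) \<le> 0"
      by (simp add: I_def b_def sum.Plus f_def g_def s_def sum_negf)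
  qed (simp_all add: I_def J_def)
  then obtain l where l: "\<And>j. j \<in> J \<Longrightarrow> 0 \<le> l j" "\<And>i. i \<in> I \<Longrightarrow> b i = (\<Sum>j\<in>J. l j * A j i)"
    by blast
  \<comment> \<open>The Farkas multipliers of the four kinds of rows are the primal solution
    together with a slack \<open>w\<close>.\<close>
  define u where "u i = l (Inl (Inl i))" for i
  define v where "v j = l (Inl (Inr j))" for j
  define t where "t i j = l (Inr (Inl (i, j)))" for i j
  define w where "w = l (Inr (Inr ()))"
  show ?thesis
  proof (rule that[of t u v])
    show "0 \<le> t i j" if "i \<in> K" "j \<in> K" for i j
      unfolding t_def by (rule l(1)) (use that in \<open>simp add: J_intro\<close>)
    show "0 \<le> u i" if "i \<in> K" for i
      unfolding u_def by (rule l(1)) (use that in \<open>simp add: J_intro\<close>)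
    show "0 \<le> v j" if "j \<in> K" for j
      unfolding v_def by (rule l(1)) (use that in \<open>simp add: J_intro\<close>)
    have sum_if: "(\<Sum>i\<in>K. if P then F i else 0) = (if P then sum F K else 0)" for P and F :: "'k \<Rightarrow> real"
      by simp
    show "m i = u i + (\<Sum>j\<in>K. t i j)" if "i \<in> K" for i
      using l(2)[of "Inl (Inl i)"] that
      by (simp add: I_intro J_def A_def b_def sum.Plus u_def t_def of_bool sum_if sum_pairs)
    show "n j = v j + (\<Sum>i\<in>K. t i j)" if "j \<in> K" for j
      using l(2)[of "Inl (Inr j)"] that
      by (simp add: I_intro J_def A_def b_def sum.Plus v_def t_def of_bool sum_negf sum_pairs)
    \<comment> \<open>The column of \<open>s\<close> gives total cost plus \<open>w\<close> equal to
      \<open>D\<close>; dropping \<open>w\<close> leaves the inequality.\<close>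
    have "0 \<le> w"
      unfolding w_def by (rule l(1)) (simp add: J_intro)
    then show "(\<Sum>i\<in>K. u i) + (\<Sum>j\<in>K. v j) + (\<Sum>i\<in>K. \<Sum>j\<in>K. t i j * d i j) \<le> D"
      using l(2)[of "Inr ()"]
      by (simp add: I_intro J_def A_def b_def sum.Plus u_def v_def t_def w_def sum_negf sum_pairs)
  qed
qed

section \<open>Test functions bound the generalized Wasserstein distance from below\<close>

definition lipschitz_unit_ball :: "('a::metric_space \<Rightarrow> real) set" where
  "lipschitz_unit_ball = {\<phi>. (\<forall>x. \<bar>\<phi> x\<bar> \<le> 1) \<and> 1-lipschitz_on UNIV \<phi>}"

lemma lipschitz_unit_ball_measurable:
  "\<phi> \<in> lipschitz_unit_ball \<Longrightarrow> \<phi> \<in> borel_measurable borel"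
  by (auto simp: lipschitz_unit_ball_def intro: borel_measurable_continuous_onI lipschitz_on_continuous_on)

text \<open>The two unit bounds already imply boundedness, continuity and a finite Lipschitz norm.
  This translates the \<open>ennreal\<close> norms into pointwise real inequalities.\<close>

lemma lipschitz_unit_ball_eq:
  "{\<phi> \<in> bounded_lipschitz_functions. sup_norm \<phi> \<le> 1 \<and> lip_norm \<phi> \<le> 1} = lipschitz_unit_ball"
proof (intro set_eqI)
  fix \<phi> :: "'a \<Rightarrow> real"
  have sup: "sup_norm \<phi> \<le> 1 \<longleftrightarrow> (\<forall>x. \<bar>\<phi> x\<bar> \<le> 1)"
    by (simp add: sup_norm_def SUP_le_iff)
  have "lip_norm \<phi> \<le> 1 \<longleftrightarrow> (\<forall>x y. x \<noteq> y \<longrightarrow> \<bar>\<phi> x - \<phi> y\<bar> \<le> dist x y)"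
    by (auto simp: lip_norm_def SUP_le_iff)
  also have "\<dots> \<longleftrightarrow> 1-lipschitz_on UNIV \<phi>"
    by (auto simp: lipschitz_on_def dist_real_def) (metis abs_zero diff_self dist_self order_refl)
  finally have lip: "lip_norm \<phi> \<le> 1 \<longleftrightarrow> 1-lipschitz_on UNIV \<phi>" .
  have "\<phi> \<in> bounded_lipschitz_functions" if "\<forall>x. \<bar>\<phi> x\<bar> \<le> 1" "1-lipschitz_on UNIV \<phi>"
    unfolding bounded_lipschitz_functions_def
  proof (safe)
    show "bounded (range \<phi>)" using that(1) by (auto simp: bounded_iff)
    show "continuous_on UNIV \<phi>" using that(2) by (rule lipschitz_on_continuous_on)
    show "lip_norm \<phi> < \<infinity>"
      using that(2) lip by (auto simp: top.not_eq_extremum[symmetric] top_unique)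
  qed
  then show "\<phi> \<in> {\<phi> \<in> bounded_lipschitz_functions. sup_norm \<phi> \<le> 1 \<and> lip_norm \<phi> \<le> 1} \<longleftrightarrow>
      \<phi> \<in> lipschitz_unit_ball"
    using sup lip by (auto simp: lipschitz_unit_ball_def)
qed

section \<open>Comparing integrals with total variation and transport cost\<close>

lemma integrable_bounded_borel:
  fixes f :: "'a::euclidean_space \<Rightarrow> real"
  assumes "M \<in> finite_borel_measures" "f \<in> borel_measurable borel" "\<And>x. \<bar>f x\<bar> \<le> B"
  shows "integrable M f"
proof (rule finite_measure.integrable_const_bound)
  show "f \<in> borel_measurable M"
    using assms(1,2) by (simp add: finite_borel_measures_def cong: measurable_cong_sets)
qed (use assms in \<open>auto simp: finite_borel_measures_def\<close>)

text \<open>Domination is available only inside \<open>Y\<close>, as on one side of a Hahn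
  decomposition. Restricting both measures to \<open>Y\<close> by a density turns it into an order
  of measures, under which nonnegative integrals are monotone.\<close>

lemma set_integral_mono_measure:
  fixes M N :: "'a::euclidean_space measure" and f :: "'a \<Rightarrow> real"
  assumes MN: "M \<in> finite_borel_measures" "N \<in> finite_borel_measures"
    and Y[measurable]: "Y \<in> sets borel"
    and le: "\<And>X. X \<in> sets borel \<Longrightarrow> X \<subseteq> Y \<Longrightarrow> emeasure N X \<le> emeasure M X"
    and f[measurable]: "f \<in> borel_measurable borel" and f_bounds: "\<And>x. 0 \<le> f x" "\<And>x. f x \<le> B"
  shows "(\<integral>x. indicator Y x * f x \<partial>N) \<le> (\<integral>x. indicator Y x * f x \<partial>M)"
proof -
  have [measurable_cong, simp]: "sets M = sets borel" "sets N = sets borel"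
    using MN by (auto simp: finite_borel_measures_def)
  have [simp]: "space M = UNIV" "space N = UNIV"
    using sets_eq_imp_space_eq[of M borel] sets_eq_imp_space_eq[of N borel] by auto
  have eq: "(\<integral>x. indicator Y x * f x \<partial>K) = enn2real (\<integral>\<^sup>+x. f x \<partial>density K (indicator Y))"
    if [measurable_cong]: "sets K = sets borel" for K
  proof -
    have "(\<integral>x. indicator Y x * f x \<partial>K) = enn2real (\<integral>\<^sup>+x. ennreal (indicator Y x * f x) \<partial>K)"
      by (rule integral_eq_nn_integral) (auto simp: f_bounds)
    also have "(\<integral>\<^sup>+x. ennreal (indicator Y x * f x) \<partial>K) = (\<integral>\<^sup>+x. indicator Y x * ennreal (f x) \<partial>K)"
      by (intro nn_integral_cong) (auto simp: indicator_def)
    also have "\<dots> = (\<integral>\<^sup>+x. f x \<partial>density K (indicator Y))"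
      by (rule nn_integral_density[symmetric]) auto
    finally show ?thesis .
  qed
  have "density N (indicator Y) \<le> density M (indicator Y)"
    unfolding le_measure_iff
  proof (simp, rule le_funI)
    fix X
    show "emeasure (density N (indicator Y)) X \<le> emeasure (density M (indicator Y)) X"
      using le[of "Y \<inter> X"]
      by (cases "X \<in> sets borel") (auto simp: emeasure_restricted emeasure_notin_sets)
  qed
  then have *: "(\<integral>\<^sup>+x. f x \<partial>density N (indicator Y)) \<le> (\<integral>\<^sup>+x. f x \<partial>density M (indicator Y))"
    by (intro nn_integral_mono_measure) auto
  \<comment> \<open>Finiteness of the larger side matters, since \<open>enn2real\<close> sends
    infinity to 0 and is monotone only below it.\<close>
  have "(\<integral>\<^sup>+x. f x \<partial>density M (indicator Y)) = (\<integral>\<^sup>+x. indicator Y x * ennreal (f x) \<partial>M)"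
    by (rule nn_integral_density) auto
  also have "\<dots> \<le> (\<integral>\<^sup>+x. ennreal B \<partial>M)"
    by (intro nn_integral_mono) (auto simp: indicator_def f_bounds ennreal_leI)
  also have "\<dots> < \<infinity>"
    using MN(1) by (auto simp: finite_borel_measures_def finite_measure.emeasure_eq_measure ennreal_mult_less_top)
  finally show ?thesis
    using * by (auto simp: eq intro: enn2real_mono)
qed

text \<open>On the Hahn set \<open>Y\<close>, where \<open>M\<close> dominates, the nonnegative
  function \<open>1 - \<phi>\<close> is compared; on the complement, where \<open>N\<close>
  dominates, \<open>1 + \<phi>\<close>. This bounds the difference by the variation over the
  two-block partition.\<close>

lemma integral_diff_le_total_variation:
  fixes M N :: "'a::euclidean_space measure" and \<phi> :: "'a \<Rightarrow> real"
  assumes MN: "M \<in> finite_borel_measures" "N \<in> finite_borel_measures"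
    and \<phi>[measurable]: "\<phi> \<in> borel_measurable borel" and \<phi>_bound: "\<And>x. \<bar>\<phi> x\<bar> \<le> 1"
  shows "ennreal ((\<integral>x. \<phi> x \<partial>M) - (\<integral>x. \<phi> x \<partial>N)) \<le>
    total_variation (\<lambda>A. measure M A - measure N A)"
proof -
  have [measurable_cong, simp]: "sets M = sets borel" "sets N = sets borel"
    and fin: "finite_measure M" "finite_measure N"
    using MN by (auto simp: finite_borel_measures_def)
  obtain Y where Y[measurable]: "Y \<in> sets borel"
    and Y1: "\<And>X. X \<in> sets borel \<Longrightarrow> X \<subseteq> Y \<Longrightarrow> emeasure N X \<le> emeasure M X"
    and Y2: "\<And>X. X \<in> sets borel \<Longrightarrow> X \<subseteq> - Y \<Longrightarrow> emeasure M X \<le> emeasure N X"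
    using finite_unsigned_Hahn_decomposition[OF fin] by (auto simp: disjoint_eq_subset_Compl)
  have split: "(\<integral>x. \<phi> x \<partial>K) = (\<integral>x. indicator Y x * \<phi> x \<partial>K) + (\<integral>x. indicator (- Y) x * \<phi> x \<partial>K)"
    and minus: "(\<integral>x. indicator Y x * (1 - \<phi> x) \<partial>K) = measure K Y - (\<integral>x. indicator Y x * \<phi> x \<partial>K)"
    and plus: "(\<integral>x. indicator (- Y) x * (1 + \<phi> x) \<partial>K) = measure K (- Y) + (\<integral>x. indicator (- Y) x * \<phi> x \<partial>K)"
    if K: "K \<in> finite_borel_measures" for K
  proof -
    have [measurable_cong, simp]: "sets K = sets borel"
      using K by (auto simp: finite_borel_measures_def)
    have ind: "integrable K (\<lambda>x. indicator Z x * \<phi> x)" "integrable K (indicator Z :: 'a \<Rightarrow> real)"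
      if [measurable]: "Z \<in> sets borel" for Z
      using \<phi>_bound by (auto intro!: integrable_bounded_borel[OF K, of _ 1] simp: indicator_def)
    have [simp]: "space K = UNIV"
      using sets_eq_imp_space_eq[of K borel] by auto
    have "(\<integral>x. indicator Y x * \<phi> x \<partial>K) + (\<integral>x. indicator (- Y) x * \<phi> x \<partial>K) =
        (\<integral>x. indicator Y x * \<phi> x + indicator (- Y) x * \<phi> x \<partial>K)"
      by (intro Bochner_Integration.integral_add[symmetric] ind) auto
    also have "\<dots> = (\<integral>x. \<phi> x \<partial>K)"
      by (intro Bochner_Integration.integral_cong) (auto simp: indicator_def)
    finally show "(\<integral>x. \<phi> x \<partial>K) = (\<integral>x. indicator Y x * \<phi> x \<partial>K) + (\<integral>x. indicator (- Y) x * \<phi> x \<partial>K)"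
      by simp
    show "(\<integral>x. indicator Y x * (1 - \<phi> x) \<partial>K) = measure K Y - (\<integral>x. indicator Y x * \<phi> x \<partial>K)"
      using ind[of Y] by (simp add: right_diff_distrib)
    show "(\<integral>x. indicator (- Y) x * (1 + \<phi> x) \<partial>K) = measure K (- Y) + (\<integral>x. indicator (- Y) x * \<phi> x \<partial>K)"
      using ind[of "- Y"] by (simp add: distrib_left)
  qed
  have bounds: "0 \<le> 1 - \<phi> x" "1 - \<phi> x \<le> 2" "0 \<le> 1 + \<phi> x" "1 + \<phi> x \<le> 2" for x
    using \<phi>_bound[of x] by linarith+
  have "(\<integral>x. indicator Y x * (1 - \<phi> x) \<partial>N) \<le> (\<integral>x. indicator Y x * (1 - \<phi> x) \<partial>M)"
    by (rule set_integral_mono_measure[OF MN, where B = 2]) (use Y1 bounds in auto)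
  moreover have "(\<integral>x. indicator (- Y) x * (1 + \<phi> x) \<partial>M) \<le> (\<integral>x. indicator (- Y) x * (1 + \<phi> x) \<partial>N)"
    by (rule set_integral_mono_measure[OF MN(2,1), where B = 2]) (use Y2 bounds in auto)
  ultimately have le: "(\<integral>x. \<phi> x \<partial>M) - (\<integral>x. \<phi> x \<partial>N) \<le>
      \<bar>measure M Y - measure N Y\<bar> + \<bar>measure M (- Y) - measure N (- Y)\<bar>"
    using split[OF MN(1)] split[OF MN(2)] minus[OF MN(1)] minus[OF MN(2)] plus[OF MN(1)] plus[OF MN(2)]
    by linarith
  let ?\<sigma> = "\<lambda>A. measure M A - measure N A"
  have "Y \<noteq> - Y" by blast
  then have "ennreal (\<bar>?\<sigma> Y\<bar> + \<bar>?\<sigma> (- Y)\<bar>) = (\<Sum>A\<in>{Y, - Y}. ennreal \<bar>?\<sigma> A\<bar>)"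
    by simp
  \<comment> \<open>One of the two blocks may be empty, and \<open>partition_on\<close> forbids an
    empty block.\<close>
  also have "\<dots> = (\<Sum>A\<in>{Y, - Y} - {{}}. ennreal \<bar>?\<sigma> A\<bar>)"
    by (rule sum.mono_neutral_right) auto
  also have "\<dots> \<le> total_variation ?\<sigma>"
    unfolding total_variation_def
    by (rule SUP_upper) (auto simp: partition_on_def disjoint_def)
  finally show ?thesis
    using le by (meson ennreal_leI order_trans)
qed

text \<open>Any coupling turns the difference of integrals into a single integral of
  \<open>\<phi> x - \<phi> y\<close>, which is at most \<open>dist x y\<close> pointwise.\<close>

lemma integral_diff_le_wasserstein1:
  fixes M N :: "'a::euclidean_space measure"
  assumes "M \<in> finite_borel_measures" and \<phi>: "\<phi> \<in> lipschitz_unit_ball"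
  shows "ennreal ((\<integral>x. \<phi> x \<partial>M) - (\<integral>x. \<phi> x \<partial>N)) \<le> wasserstein1 M N"
  unfolding wasserstein1_def
proof (rule INF_greatest)
  fix \<pi> assume "\<pi> \<in> couplings M N"
  then have [measurable_cong]: "sets \<pi> = sets (borel \<Otimes>\<^sub>M borel)"
    and M: "distr \<pi> borel fst = M" and N: "distr \<pi> borel snd = N"
    by (auto simp: couplings_def)
  note [measurable] = lipschitz_unit_ball_measurable[OF \<phi>]
  have bound: "\<bar>\<phi> x\<bar> \<le> 1" and lip: "\<phi> x - \<phi> y \<le> dist x y" for x y
    using \<phi> lipschitz_onD[of 1 UNIV \<phi> x y]
    by (auto simp: lipschitz_unit_ball_def dist_real_def)
  \<comment> \<open>Finiteness of a coupling is inherited from its first marginal.\<close>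
  interpret finite_measure \<pi>
  proof
    have "emeasure \<pi> (space \<pi>) = emeasure M UNIV"
      by (simp add: emeasure_distr flip: M)
    then show "emeasure \<pi> (space \<pi>) \<noteq> \<infinity>"
      using assms(1) by (simp add: finite_borel_measures_def finite_measure.emeasure_finite)
  qed
  have int: "integrable \<pi> (\<lambda>z. \<phi> (fst z))" "integrable \<pi> (\<lambda>z. \<phi> (snd z))"
    by (rule integrable_const_bound[where B = 1]; use bound in simp)+
  have "(\<integral>x. \<phi> x \<partial>M) - (\<integral>x. \<phi> x \<partial>N) = (\<integral>z. \<phi> (fst z) - \<phi> (snd z) \<partial>\<pi>)"
    unfolding M[symmetric] N[symmetric] using int by (simp add: integral_distr)
  also have "ennreal \<dots> \<le> (\<integral>\<^sup>+z. ennreal (\<phi> (fst z) - \<phi> (snd z)) \<partial>\<pi>)"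
  proof -
    let ?g = "\<lambda>z. \<phi> (fst z) - \<phi> (snd z)"
    have "(\<integral>z. ?g z \<partial>\<pi>) \<le> enn2real (\<integral>\<^sup>+z. ennreal (?g z) \<partial>\<pi>)"
      using int by (subst real_lebesgue_integral_def) auto
    then show ?thesis
      using ennreal_leI by (cases "\<integral>\<^sup>+z. ennreal (?g z) \<partial>\<pi>") auto
  qed
  also have "\<dots> \<le> (\<integral>\<^sup>+(x, y). ennreal (dist x y) \<partial>\<pi>)"
    by (intro nn_integral_mono) (auto simp: lip intro: ennreal_leI)
  finally show "ennreal ((\<integral>x. \<phi> x \<partial>M) - (\<integral>x. \<phi> x \<partial>N)) \<le> (\<integral>\<^sup>+(x, y). ennreal (dist x y) \<partial>\<pi>)" .
qed

text \<open>Only an inequality, because \<open>ennreal\<close> truncates negative reals to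
  0.\<close>

lemma ennreal_add_le: "ennreal (a + b) \<le> ennreal a + ennreal b"
  by (cases "0 \<le> a"; cases "0 \<le> b") (auto simp: ennreal_neg intro: ennreal_leI)

lemma integral_diff_le_gen_wasserstein:
  fixes M N :: "'a::euclidean_space measure"
  assumes MN: "M \<in> finite_borel_measures" "N \<in> finite_borel_measures"
    and \<phi>: "\<phi> \<in> lipschitz_unit_ball"
  shows "ennreal ((\<integral>x. \<phi> x \<partial>M) - (\<integral>x. \<phi> x \<partial>N)) \<le> gen_wasserstein 1 1 M N"
  unfolding gen_wasserstein_def
proof (rule INF_greatest, clarify)
  fix M' N' :: "'a measure"
  assume M'N': "M' \<in> finite_borel_measures" "N' \<in> finite_borel_measures"
  let ?I = "\<lambda>K. \<integral>x. \<phi> x \<partial>K"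
  have [measurable]: "\<phi> \<in> borel_measurable borel" and bound: "\<bar>\<phi> x\<bar> \<le> 1" for x
    using lipschitz_unit_ball_measurable[OF \<phi>] \<phi> by (auto simp: lipschitz_unit_ball_def)
  have "ennreal (?I M - ?I N) = ennreal ((?I M - ?I M') + (?I N' - ?I N) + (?I M' - ?I N'))"
    by simp
  also have "\<dots> \<le> ennreal (?I M - ?I M') + ennreal (?I N' - ?I N) + ennreal (?I M' - ?I N')"
    by (meson ennreal_add_le add_right_mono order_trans)
  also have "\<dots> \<le> ennreal 1 * (total_variation (\<lambda>A. measure M A - measure M' A) +
      total_variation (\<lambda>A. measure N A - measure N' A)) + ennreal 1 * wasserstein1 M' N'"
    \<comment> \<open>The terms for \<open>N\<close> and \<open>N'\<close> occur in the opposite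
      order, hence the test function \<open>- \<phi>\<close> for that pair.\<close>
    using integral_diff_le_total_variation[OF MN(1) M'N'(1), of \<phi>]
      integral_diff_le_total_variation[OF MN(2) M'N'(2), of "\<lambda>x. - \<phi> x"]
      integral_diff_le_wasserstein1[OF M'N'(1) \<phi>, of N'] bound
    by (auto intro!: add_mono)
  finally show "ennreal (?I M - ?I N) \<le> \<dots>" .
qed

section \<open>Nearly optimal transport plans\<close>

lemma finite_borel_measuresD:
  assumes "M \<in> finite_borel_measures"
  shows "finite_measure M" "sets M = sets borel" "space M = UNIV"
  using assms sets_eq_imp_space_eq[of M borel] by (auto simp: finite_borel_measures_def)

text \<open>Under domination the absolute values disappear, and the sum over every partition is the
  difference of the total masses.\<close>

lemma total_variation_diff_le:
  assumes M: "M \<in> finite_borel_measures" and N: "N \<in> finite_borel_measures"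
    and le: "\<And>A. A \<in> sets borel \<Longrightarrow> measure N A \<le> measure M A"
  shows "total_variation (\<lambda>A. measure M A - measure N A) \<le> ennreal (measure M UNIV - measure N UNIV)"
  unfolding total_variation_def
proof (rule SUP_least, clarify)
  fix \<A> :: "'a set set" assume \<A>: "finite \<A>" "\<A> \<subseteq> sets borel" "partition_on UNIV \<A>"
  have "disjoint_family_on (\<lambda>A. A) \<A>"
    using \<A>(3) by (auto simp: partition_on_def disjoint_def disjoint_family_on_def)
  then have sum: "(\<Sum>A\<in>\<A>. measure K A) = measure K UNIV" if "K \<in> finite_borel_measures" for K
    using finite_measure.finite_measure_finite_Union[of K \<A> "\<lambda>A. A"] \<A> finite_borel_measuresD[OF that]
    by (auto simp: partition_on_def)
  have "(\<Sum>A\<in>\<A>. ennreal \<bar>measure M A - measure N A\<bar>) = (\<Sum>A\<in>\<A>. ennreal (measure M A - measure N A))"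
    using le \<A>(2) by (intro sum.cong) auto
  also have "\<dots> = ennreal (\<Sum>A\<in>\<A>. measure M A - measure N A)"
    using le \<A>(2) by (intro sum_ennreal) auto
  also have "\<dots> = ennreal (measure M UNIV - measure N UNIV)"
    by (simp add: sum_subtractf sum M N)
  finally show "(\<Sum>A\<in>\<A>. ennreal \<bar>measure M A - measure N A\<bar>) \<le> ennreal (measure M UNIV - measure N UNIV)"
    by simp
qed

section \<open>Discretization of the space and of the test functions\<close>

text \<open>The balls of radius \<open>e\<close> around a countable dense set cover the space;
  making them disjoint gives the cells. The uncovered remainders decrease to the empty set, so one
  \<open>n\<close> serves both finite measures. Cells may be empty, and \<open>x k\<close> need not
  lie in \<open>A k\<close>.\<close>

lemma small_cells:
  fixes M N :: "'a::euclidean_space measure"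
  assumes M: "M \<in> finite_borel_measures" and N: "N \<in> finite_borel_measures" and "0 < e"
  obtains A :: "nat \<Rightarrow> 'a set" and x :: "nat \<Rightarrow> 'a" and n :: nat where
    "\<And>k. A k \<in> sets borel" "disjoint_family A" "\<And>k y. y \<in> A k \<Longrightarrow> dist y (x k) \<le> e"
    "measure M (- (\<Union>k<n. A k)) \<le> e" "measure N (- (\<Union>k<n. A k)) \<le> e"
proof -
  obtain D :: "'a set" where D: "countable D" "\<And>X. open X \<Longrightarrow> X \<noteq> {} \<Longrightarrow> \<exists>d\<in>D. d \<in> X"
    by (rule countable_dense_setE) blast
  have "D \<noteq> {}" using D(2)[of UNIV] by auto
  define x where "x = from_nat_into D"
  define A where "A = disjointed (\<lambda>k. ball (x k) e)"
  have A[measurable]: "A k \<in> sets borel" for k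
    unfolding A_def disjointed_def by measurable
  have "(\<Union>k. A k) = UNIV"
  proof -
    have "\<exists>k. y \<in> ball (x k) e" for y
    proof -
      obtain d where "d \<in> D" "d \<in> ball y e"
        using D(2)[of "ball y e"] \<open>0 < e\<close> by auto
      moreover obtain k where "d = x k"
        using from_nat_into_surj[OF D(1) \<open>d \<in> D\<close>] by (auto simp: x_def)
      ultimately show ?thesis by (auto simp: dist_commute)
    qed
    then show ?thesis by (auto simp: A_def UN_disjointed_eq)
  qed
  have inter: "(\<Inter>n. - (\<Union>k<n. A k)) = {}"
  proof -
    have "\<exists>n. y \<in> (\<Union>k<n. A k)" for y
    proof -
      obtain k where "y \<in> A k" using \<open>(\<Union>k. A k) = UNIV\<close> by blast
      then show ?thesis by (intro exI[of _ "Suc k"]) blast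
    qed
    then show ?thesis by blast
  qed
  have "eventually (\<lambda>n. measure K (- (\<Union>k<n. A k)) < e) sequentially" if "K \<in> finite_borel_measures" for K
  proof -
    interpret finite_measure K by (rule finite_borel_measuresD[OF that])
    have "(\<lambda>n. measure K (- (\<Union>k<n. A k))) \<longlonglongrightarrow> measure K (\<Inter>n. - (\<Union>k<n. A k))"
    proof (rule finite_Lim_measure_decseq)
      show "range (\<lambda>n. - (\<Union>k<n. A k)) \<subseteq> sets K"
      proof (rule image_subsetI)
        show "- (\<Union>k<n. A k) \<in> sets K" for n
          unfolding finite_borel_measuresD(2)[OF that] by (intro borel_comp sets.finite_UN) auto
      qed
      show "decseq (\<lambda>n. - (\<Union>k<n. A k))"
        by (fastforce simp: decseq_def)
    qed
    then have "(\<lambda>n. measure K (- (\<Union>k<n. A k))) \<longlonglongrightarrow> 0"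
      by (simp only: inter measure_empty)
    then show ?thesis
      using \<open>0 < e\<close> by (rule order_tendstoD(2))
  qed
  from eventually_conj[OF this[OF M] this[OF N]]
  obtain n where "measure M (- (\<Union>k<n. A k)) < e" "measure N (- (\<Union>k<n. A k)) < e"
    by (auto simp: eventually_sequentially)
  moreover have "dist y (x k) \<le> e" if "y \<in> A k" for y k
    using that disjointed_subset[of "\<lambda>k. ball (x k) e" k] by (auto simp: A_def dist_commute)
  ultimately show thesis
    using disjoint_family_disjointed[of "\<lambda>k. ball (x k) e"]
    by (intro that[of A x n] A) (auto simp: less_imp_le simp flip: A_def)
qed

text \<open>The infimum of the cones \<open>g j + dist y (x j)\<close>, cut off at 1, as in the
  McShane extension. The last conclusion expresses that a minimum is above every common lower bound;
  it also yields the Lipschitz estimate and the bound \<open>- 1\<close>.\<close>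

lemma lipschitz_interpolation:
  fixes x :: "'k \<Rightarrow> 'a::metric_space"
  assumes "finite K" and g: "\<And>j. j \<in> K \<Longrightarrow> - 1 \<le> g j"
  obtains h where "h \<in> lipschitz_unit_ball" "\<And>j. j \<in> K \<Longrightarrow> h (x j) \<le> g j"
    "\<And>y c. c \<le> 1 \<Longrightarrow> (\<And>j. j \<in> K \<Longrightarrow> c - g j \<le> dist y (x j)) \<Longrightarrow> c \<le> h y"
proof
  define h where "h y = Min (insert 1 ((\<lambda>j. g j + dist y (x j)) ` K))" for y
  have le: "h y \<le> 1" "\<And>j. j \<in> K \<Longrightarrow> h y \<le> g j + dist y (x j)" for y
    using \<open>finite K\<close> by (auto simp: h_def intro: Min_le)
  show ge: "c \<le> h y" if "c \<le> 1" "\<And>j. j \<in> K \<Longrightarrow> c - g j \<le> dist y (x j)" for y c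
    using \<open>finite K\<close> that by (auto simp: h_def algebra_simps)
  show "h (x j) \<le> g j" if "j \<in> K" for j
    using le(2)[OF that, of "x j"] by simp
  \<comment> \<open>By the triangle inequality, \<open>h y - dist y z\<close> is a common lower
    bound at \<open>z\<close>.\<close>
  have diff: "h y - dist y z \<le> h z" for y z
  proof (rule ge)
    show "h y - dist y z \<le> 1" using le(1)[of y] zero_le_dist[of y z] by linarith
    show "h y - dist y z - g j \<le> dist z (x j)" if "j \<in> K" for j
      using le(2)[OF that, of y] dist_triangle[of y "x j" z] by linarith
  qed
  have "- 1 \<le> h y" for y
    using g by (intro ge) (auto intro: order_trans[OF _ zero_le_dist])
  then have "\<bar>h y\<bar> \<le> 1" for y
    using le(1)[of y] by (simp add: abs_le_iff minus_le_iff)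
  moreover have "1-lipschitz_on UNIV h"
  proof (rule lipschitz_onI)
    show "dist (h y) (h z) \<le> 1 * dist y z" for y z
      using diff[of y z] diff[of z y] by (auto simp: dist_real_def dist_commute abs_le_iff)
  qed simp
  ultimately show "h \<in> lipschitz_unit_ball"
    by (simp add: lipschitz_unit_ball_def)
qed

text \<open>The step function equal to \<open>c k\<close> on the cells and to \<open>- 1\<close> on
  the remainder lies below \<open>h\<close>.\<close>

lemma cells_le_integral:
  fixes h :: "'a::euclidean_space \<Rightarrow> real"
  assumes M: "M \<in> finite_borel_measures" and "finite K"
    and A[measurable]: "\<And>k. A k \<in> sets borel" and disj: "disjoint_family_on A K"
    and h[measurable]: "h \<in> borel_measurable borel" and bound: "\<And>y. \<bar>h y\<bar> \<le> 1"
    and c: "\<And>k y. k \<in> K \<Longrightarrow> y \<in> A k \<Longrightarrow> c k \<le> h y"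
  shows "(\<Sum>k\<in>K. measure M (A k) * c k) - measure M (- (\<Union>k\<in>K. A k)) \<le> (\<integral>y. h y \<partial>M)"
proof -
  note M' = finite_borel_measuresD[OF M]
  interpret finite_measure M by (rule M')
  define R where "R = - (\<Union>k\<in>K. A k)"
  have [measurable]: "R \<in> sets borel"
    unfolding R_def using \<open>finite K\<close> by (intro borel_comp sets.finite_UN) auto
  have ind: "integrable M (indicator B :: 'a \<Rightarrow> real)" if "B \<in> sets borel" for B
    using that by (auto intro!: integrable_bounded_borel[OF M, of _ 1] simp: indicator_def)
  have int: "integrable M (\<lambda>y. \<Sum>k\<in>K. indicator (A k) y * c k)" "integrable M (indicator R :: 'a \<Rightarrow> real)"
    using ind by auto
  have "(\<Sum>k\<in>K. measure M (A k) * c k) - measure M R =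
      (\<integral>y. (\<Sum>k\<in>K. indicator (A k) y * c k) - indicator R y \<partial>M)"
    using int ind by (simp add: M')
  also have "\<dots> \<le> (\<integral>y. h y \<partial>M)"
  proof (rule integral_mono)
    show "integrable M (\<lambda>y. (\<Sum>k\<in>K. indicator (A k) y * c k) - indicator R y)"
      using int by (rule Bochner_Integration.integrable_diff)
    show "integrable M h"
      by (rule integrable_bounded_borel[OF M h bound])
    fix y
    show "(\<Sum>k\<in>K. indicator (A k) y * c k) - indicator R y \<le> h y"
    proof (cases "y \<in> (\<Union>k\<in>K. A k)")
      case True
      then obtain k where k: "k \<in> K" "y \<in> A k" by blast
      then have "(\<Sum>k\<in>K. indicator (A k) y * c k) = c k"
        using \<open>finite K\<close> disj
        by (subst sum.remove[of _ k])
          (auto intro!: sum.neutral simp: disjoint_family_on_def indicator_def)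
      then show ?thesis using c[OF k] True by (simp add: R_def)
    next
      case False
      then have "(\<Sum>k\<in>K. indicator (A k) y * c k) = 0"
        by (intro sum.neutral) auto
      then show ?thesis using False bound[of y] by (simp add: R_def abs_le_iff)
    qed
  qed
  finally show ?thesis unfolding R_def .
qed

section \<open>From a finite plan to a measure on the product\<close>

text \<open>The fractions \<open>t i j / m i\<close> of a row sum to at most 1. With
  \<open>a i\<close> the mass of a Borel set inside cell \<open>i\<close>, this shows that a
  marginal of the spread-out plan is dominated by the original measure.\<close>

lemma sum_plan_le:
  fixes t :: "'k \<Rightarrow> 'l \<Rightarrow> real"
  assumes "finite K" "finite L" and t: "\<And>i j. i \<in> K \<Longrightarrow> j \<in> L \<Longrightarrow> 0 \<le> t i j"
    and m: "\<And>i. i \<in> K \<Longrightarrow> (\<Sum>j\<in>L. t i j) \<le> m i" and a: "\<And>i. i \<in> K \<Longrightarrow> 0 \<le> a i"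
  shows "(\<Sum>i\<in>K. \<Sum>j\<in>L. t i j / (m i * n j) * a i * n j) \<le> (\<Sum>i\<in>K. a i)"
proof (rule sum_mono)
  fix i assume i: "i \<in> K"
  have m0: "0 \<le> m i"
    using order_trans[OF sum_nonneg m[OF i]] t i by blast
  \<comment> \<open>If \<open>n j = 0\<close>, the left summand is 0, so cancelling
    \<open>n j\<close> gives only an inequality.\<close>
  have "(\<Sum>j\<in>L. t i j / (m i * n j) * a i * n j) \<le> (\<Sum>j\<in>L. t i j / m i * a i)"
    using t[OF i] a[OF i] m0 by (intro sum_mono) auto
  also have "\<dots> = (\<Sum>j\<in>L. t i j) / m i * a i"
    by (simp add: sum_divide_distrib sum_distrib_right)
  also have "\<dots> \<le> 1 * a i"
    using m[OF i] m0 a[OF i] by (intro mult_right_mono) (auto simp: divide_le_eq_1)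
  finally show "(\<Sum>j\<in>L. t i j / (m i * n j) * a i * n j) \<le> a i" by simp
qed

lemma nn_integral_double_sum_indicator:
  assumes "\<And>i j. i \<in> I \<Longrightarrow> j \<in> J \<Longrightarrow> X i j \<in> sets M"
  shows "(\<integral>\<^sup>+z. (\<Sum>i\<in>I. \<Sum>j\<in>J. a i j * indicator (X i j) z) \<partial>M) =
    (\<Sum>i\<in>I. \<Sum>j\<in>J. a i j * emeasure M (X i j))"
proof -
  have "(\<integral>\<^sup>+z. (\<Sum>i\<in>I. \<Sum>j\<in>J. a i j * indicator (X i j) z) \<partial>M) =
      (\<Sum>i\<in>I. \<integral>\<^sup>+z. (\<Sum>j\<in>J. a i j * indicator (X i j) z) \<partial>M)"
    using assms by (intro nn_integral_sum borel_measurable_sum) auto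
  also have "\<dots> = (\<Sum>i\<in>I. \<Sum>j\<in>J. \<integral>\<^sup>+z. a i j * indicator (X i j) z \<partial>M)"
    using assms by (intro sum.cong refl nn_integral_sum) auto
  also have "\<dots> = (\<Sum>i\<in>I. \<Sum>j\<in>J. a i j * emeasure M (X i j))"
    using assms by (intro sum.cong refl nn_integral_cmult_indicator) auto
  finally show ?thesis .
qed

text \<open>Untransported mass and mass outside the cells are paid as total variation. The
  additional \<open>2 * e\<close> per unit of transported mass pays for replacing points by the
  centres of their cells.\<close>

lemma gen_wasserstein_le_plan:
  fixes M N :: "'a::euclidean_space measure" and x :: "'k \<Rightarrow> 'a"
  assumes M: "M \<in> finite_borel_measures" and N: "N \<in> finite_borel_measures" and [simp]: "finite K"
    and A[measurable]: "\<And>k. A k \<in> sets borel" and disj: "disjoint_family_on A K"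
    and diam: "\<And>k y. k \<in> K \<Longrightarrow> y \<in> A k \<Longrightarrow> dist y (x k) \<le> e"
    and t: "\<And>i j. i \<in> K \<Longrightarrow> j \<in> K \<Longrightarrow> 0 \<le> t i j"
    and u: "\<And>i. i \<in> K \<Longrightarrow> 0 \<le> u i" and v: "\<And>j. j \<in> K \<Longrightarrow> 0 \<le> v j"
    and m: "\<And>i. i \<in> K \<Longrightarrow> measure M (A i) = u i + (\<Sum>j\<in>K. t i j)"
    and n: "\<And>j. j \<in> K \<Longrightarrow> measure N (A j) = v j + (\<Sum>i\<in>K. t i j)"
    and "0 \<le> e"
  shows "gen_wasserstein 1 1 M N \<le>
    ennreal (measure M (- (\<Union>k\<in>K. A k)) + measure N (- (\<Union>k\<in>K. A k)) + (\<Sum>i\<in>K. u i) + (\<Sum>j\<in>K. v j)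
      + (\<Sum>i\<in>K. \<Sum>j\<in>K. t i j * (dist (x i) (x j) + 2 * e)))"
proof -
  note M' = finite_borel_measuresD[OF M] and N' = finite_borel_measuresD[OF N]
  note [measurable_cong] = M'(2) N'(2)
  interpret M: finite_measure M by (rule M')
  interpret N: finite_measure N by (rule N')
  let ?m = "\<lambda>i. measure M (A i)" and ?n = "\<lambda>j. measure N (A j)"
  \<comment> \<open>The constant density with respect to the product measure that gives
    \<open>A i \<times> A j\<close> the mass \<open>t i j\<close>.\<close>
  define c where "c i j = t i j / (?m i * ?n j)" for i j
  have c: "0 \<le> c i j" if "i \<in> K" "j \<in> K" for i j
    using t[OF that] by (simp add: c_def)
  have t_le: "t i j \<le> ?m i" "t i j \<le> ?n j" if "i \<in> K" "j \<in> K" for i j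
  proof -
    have "t i j \<le> (\<Sum>j\<in>K. t i j)" "t i j \<le> (\<Sum>i\<in>K. t i j)"
      using t that by (auto intro!: member_le_sum)
    then show "t i j \<le> ?m i" "t i j \<le> ?n j"
      using u[of i] v[of j] m[of i] n[of j] that by auto
  qed
  \<comment> \<open>If a cell has mass zero then \<open>t i j = 0\<close>, so the value \<open>x / 0 = 0\<close> is harmless in \<open>c\<close>.\<close>
  have c_t: "c i j * ?m i * ?n j = t i j" if "i \<in> K" "j \<in> K" for i j
    using t_le[OF that] t[OF that] by (auto simp: c_def)
  define F where "F z = (\<Sum>i\<in>K. \<Sum>j\<in>K. ennreal (c i j) * indicator (A i \<times> A j) z)" for z
  have [measurable]: "F \<in> borel_measurable (M \<Otimes>\<^sub>M N)"
    unfolding F_def by measurable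
  define \<pi> where "\<pi> = density (M \<Otimes>\<^sub>M N) F"
  have sets_\<pi>: "sets \<pi> = sets (borel \<Otimes>\<^sub>M borel)"
    unfolding \<pi>_def sets_density by (intro sets_pair_measure_cong M' N')
  note [measurable_cong] = sets_\<pi>
  \<comment> \<open>Rectangles suffice, since the marginals only involve the strips
    \<open>B \<times> UNIV\<close> and \<open>UNIV \<times> B\<close>.\<close>
  have integral_cell: "(\<integral>\<^sup>+z. F z * indicator (B \<times> C) z \<partial>(M \<Otimes>\<^sub>M N)) =
      ennreal (\<Sum>i\<in>K. \<Sum>j\<in>K. c i j * measure M (A i \<inter> B) * measure N (A j \<inter> C))"
    if [measurable]: "B \<in> sets borel" "C \<in> sets borel" for B C
  proof -
    have "(\<integral>\<^sup>+z. F z * indicator (B \<times> C) z \<partial>(M \<Otimes>\<^sub>M N)) =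
       (\<integral>\<^sup>+z. (\<Sum>i\<in>K. \<Sum>j\<in>K. ennreal (c i j) * indicator ((A i \<inter> B) \<times> (A j \<inter> C)) z) \<partial>(M \<Otimes>\<^sub>M N))"
      by (intro nn_integral_cong) (auto simp: F_def sum_distrib_right indicator_def intro!: sum.cong)
    also have "\<dots> = (\<Sum>i\<in>K. \<Sum>j\<in>K. ennreal (c i j) * emeasure (M \<Otimes>\<^sub>M N) ((A i \<inter> B) \<times> (A j \<inter> C)))"
      by (intro nn_integral_double_sum_indicator) simp
    also have "\<dots> = (\<Sum>i\<in>K. \<Sum>j\<in>K. ennreal (c i j * measure M (A i \<inter> B) * measure N (A j \<inter> C)))"
      by (intro sum.cong refl)
        (simp add: N.emeasure_pair_measure_Times M.emeasure_eq_measure N.emeasure_eq_measure c ennreal_mult mult.assoc)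
    also have "\<dots> = ennreal (\<Sum>i\<in>K. \<Sum>j\<in>K. c i j * measure M (A i \<inter> B) * measure N (A j \<inter> C))"
      using c by (simp add: sum_ennreal sum_nonneg)
    finally show ?thesis .
  qed
  have emeasure_\<pi>: "emeasure \<pi> (B \<times> C) = ennreal (\<Sum>i\<in>K. \<Sum>j\<in>K. c i j * measure M (A i \<inter> B) * measure N (A j \<inter> C))"
    if "B \<in> sets borel" "C \<in> sets borel" for B C
    using integral_cell[OF that] that unfolding \<pi>_def by (subst emeasure_density) auto
  \<comment> \<open>Taking the marginals of \<open>\<pi>\<close> as intermediate measures makes
    \<open>\<pi>\<close> a coupling of them by definition.\<close>
  define M1 where "M1 = distr \<pi> borel fst"
  define N1 where "N1 = distr \<pi> borel snd"
  have sp: "space \<pi> = UNIV"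
    using sets_eq_imp_space_eq[OF sets_\<pi>] by (simp add: space_pair_measure)
  have M1: "emeasure M1 B = ennreal (\<Sum>i\<in>K. \<Sum>j\<in>K. c i j * measure M (A i \<inter> B) * ?n j)"
    and N1: "emeasure N1 B = ennreal (\<Sum>i\<in>K. \<Sum>j\<in>K. c i j * ?m i * measure N (A j \<inter> B))"
    if [measurable]: "B \<in> sets borel" for B
  proof -
    have "fst -` B = B \<times> (UNIV :: 'a set)" "snd -` B = (UNIV :: 'a set) \<times> B" by auto
    then show "emeasure M1 B = ennreal (\<Sum>i\<in>K. \<Sum>j\<in>K. c i j * measure M (A i \<inter> B) * ?n j)"
      "emeasure N1 B = ennreal (\<Sum>i\<in>K. \<Sum>j\<in>K. c i j * ?m i * measure N (A j \<inter> B))"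
      using emeasure_\<pi>[of B UNIV] emeasure_\<pi>[of UNIV B]
      by (simp_all add: M1_def N1_def emeasure_distr sp)
  qed
  have M1_fin: "M1 \<in> finite_borel_measures" and N1_fin: "N1 \<in> finite_borel_measures"
    unfolding finite_borel_measures_def
    using M1[of UNIV] N1[of UNIV] by (auto simp: M1_def N1_def intro!: finite_measureI)
  have total: "measure M1 UNIV = (\<Sum>i\<in>K. \<Sum>j\<in>K. t i j)" "measure N1 UNIV = (\<Sum>i\<in>K. \<Sum>j\<in>K. t i j)"
    using M1[of UNIV] N1[of UNIV] t
    by (auto intro!: measure_eq_emeasure_eq_ennreal simp: c_t sum_nonneg)
  have cells_le: "(\<Sum>k\<in>K. measure L (A k \<inter> B)) \<le> measure L B"
    if L: "L \<in> finite_borel_measures" and B: "B \<in> sets borel" for L B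
  proof -
    note L = finite_borel_measuresD[OF L]
    interpret L: finite_measure L by (rule L)
    have "(\<Sum>k\<in>K. measure L (A k \<inter> B)) = measure L (\<Union>k\<in>K. A k \<inter> B)"
      using disj B by (intro L.finite_measure_finite_Union[symmetric]) (auto simp: L disjoint_family_on_def)
    also have "\<dots> \<le> measure L B"
      using B by (intro L.finite_measure_mono) (auto simp: L)
    finally show ?thesis .
  qed
  have M1_le: "measure M1 B \<le> measure M B" if "B \<in> sets borel" for B
  proof -
    have "measure M1 B = (\<Sum>i\<in>K. \<Sum>j\<in>K. t i j / (?m i * ?n j) * measure M (A i \<inter> B) * ?n j)"
      unfolding c_def[symmetric] using c by (intro measure_eq_emeasure_eq_ennreal M1 that sum_nonneg mult_nonneg_nonneg) auto
    also have "\<dots> \<le> (\<Sum>i\<in>K. measure M (A i \<inter> B))"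
      using m t u by (intro sum_plan_le) auto
    finally show ?thesis using cells_le[OF M that] by simp
  qed
  have N1_le: "measure N1 B \<le> measure N B" if "B \<in> sets borel" for B
  proof -
    have "measure N1 B = (\<Sum>i\<in>K. \<Sum>j\<in>K. t i j / (?m i * ?n j) * ?m i * measure N (A j \<inter> B))"
      unfolding c_def[symmetric] using c by (intro measure_eq_emeasure_eq_ennreal N1 that sum_nonneg mult_nonneg_nonneg) auto
    \<comment> \<open>Exchanging the sums gives the second marginal the shape of
      \<open>sum_plan_le\<close>, with rows and columns interchanged.\<close>
    also have "\<dots> = (\<Sum>j\<in>K. \<Sum>i\<in>K. t i j / (?n j * ?m i) * measure N (A j \<inter> B) * ?m i)"
      by (subst sum.swap) (simp only: mult_ac)
    also have "\<dots> \<le> (\<Sum>j\<in>K. measure N (A j \<inter> B))"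
      using n t v by (intro sum_plan_le) auto
    finally show ?thesis using cells_le[OF N that] by simp
  qed
  have mass: "measure L UNIV = measure L (- (\<Union>k\<in>K. A k)) + (\<Sum>k\<in>K. measure L (A k))"
    if L: "L \<in> finite_borel_measures" for L
  proof -
    note L = finite_borel_measuresD[OF L]
    interpret L: finite_measure L by (rule L)
    have "measure L (\<Union>k\<in>K. A k) = (\<Sum>k\<in>K. measure L (A k))"
      using disj by (intro L.finite_measure_finite_Union) (auto simp: L)
    moreover have "measure L (UNIV - (\<Union>k\<in>K. A k)) = measure L UNIV - measure L (\<Union>k\<in>K. A k)"
      using L.finite_measure_compl[of "\<Union>k\<in>K. A k"] by (simp add: L sets.finite_UN)
    ultimately show ?thesis by (simp add: Compl_eq_Diff_UNIV)
  qed
  have tv: "total_variation (\<lambda>B. measure M B - measure M1 B) + total_variation (\<lambda>B. measure N B - measure N1 B)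
      \<le> ennreal (measure M (- (\<Union>k\<in>K. A k)) + measure N (- (\<Union>k\<in>K. A k)) + (\<Sum>i\<in>K. u i) + (\<Sum>j\<in>K. v j))"
  proof -
    let ?rM = "measure M (- (\<Union>k\<in>K. A k))" and ?rN = "measure N (- (\<Union>k\<in>K. A k))"
    have "measure M UNIV - measure M1 UNIV = ?rM + (\<Sum>i\<in>K. u i)"
      using m by (simp add: mass[OF M] total sum.distrib)
    moreover have "measure N UNIV - measure N1 UNIV = ?rN + (\<Sum>j\<in>K. v j)"
      using n sum.swap[of t K K] by (simp add: mass[OF N] total sum.distrib)
    ultimately have "total_variation (\<lambda>B. measure M B - measure M1 B) + total_variation (\<lambda>B. measure N B - measure N1 B)
        \<le> ennreal (?rM + (\<Sum>i\<in>K. u i)) + ennreal (?rN + (\<Sum>j\<in>K. v j))"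
      using add_mono[OF total_variation_diff_le[OF M M1_fin M1_le] total_variation_diff_le[OF N N1_fin N1_le]]
      by metis
    also have "\<dots> = ennreal ((?rM + (\<Sum>i\<in>K. u i)) + (?rN + (\<Sum>j\<in>K. v j)))"
      by (rule ennreal_plus[symmetric]) (auto intro!: add_nonneg_nonneg sum_nonneg u v)
    also have "(?rM + (\<Sum>i\<in>K. u i)) + (?rN + (\<Sum>j\<in>K. v j)) = ?rM + ?rN + (\<Sum>i\<in>K. u i) + (\<Sum>j\<in>K. v j)"
      by linarith
    finally show ?thesis .
  qed
  have "wasserstein1 M1 N1 \<le> (\<integral>\<^sup>+(y, z). ennreal (dist y z) \<partial>\<pi>)"
    unfolding wasserstein1_def by (rule INF_lower) (simp add: couplings_def sets_\<pi> M1_def N1_def)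
  also have "\<dots> = (\<integral>\<^sup>+z. F z * ennreal (dist (fst z) (snd z)) \<partial>(M \<Otimes>\<^sub>M N))"
    unfolding \<pi>_def case_prod_unfold by (rule nn_integral_density) auto
  also have "\<dots> \<le> (\<integral>\<^sup>+z. (\<Sum>i\<in>K. \<Sum>j\<in>K. ennreal (c i j * (dist (x i) (x j) + 2 * e)) * indicator (A i \<times> A j) z) \<partial>(M \<Otimes>\<^sub>M N))"
    unfolding F_def sum_distrib_right
  proof (intro nn_integral_mono sum_mono)
    fix z i j assume ij: "i \<in> K" "j \<in> K"
    have "dist (fst z) (snd z) \<le> dist (x i) (x j) + 2 * e" if "fst z \<in> A i" "snd z \<in> A j"
      using diam[OF ij(1) that(1)] diam[OF ij(2) that(2)]
        dist_triangle[of "fst z" "snd z" "x i"] dist_triangle[of "x i" "snd z" "x j"]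
      by (simp add: dist_commute)
    then show "ennreal (c i j) * indicator (A i \<times> A j) z * ennreal (dist (fst z) (snd z))
        \<le> ennreal (c i j * (dist (x i) (x j) + 2 * e)) * indicator (A i \<times> A j) z"
      using c[OF ij] by (auto simp: indicator_def mem_Times_iff intro!: ennreal_leI mult_left_mono simp flip: ennreal_mult)
  qed
  also have "\<dots> = (\<Sum>i\<in>K. \<Sum>j\<in>K. ennreal (c i j * (dist (x i) (x j) + 2 * e)) * emeasure (M \<Otimes>\<^sub>M N) (A i \<times> A j))"
    by (intro nn_integral_double_sum_indicator) simp
  also have "\<dots> = (\<Sum>i\<in>K. \<Sum>j\<in>K. ennreal (t i j * (dist (x i) (x j) + 2 * e)))"
  proof (intro sum.cong refl)
    fix i j assume ij: "i \<in> K" "j \<in> K"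
    have "ennreal (c i j * (dist (x i) (x j) + 2 * e)) * emeasure (M \<Otimes>\<^sub>M N) (A i \<times> A j) =
        ennreal (c i j * (dist (x i) (x j) + 2 * e) * (?m i * ?n j))"
      using c[OF ij] \<open>0 \<le> e\<close>
      by (simp add: N.emeasure_pair_measure_Times M.emeasure_eq_measure N.emeasure_eq_measure flip: ennreal_mult)
    also have "c i j * (dist (x i) (x j) + 2 * e) * (?m i * ?n j) = t i j * (dist (x i) (x j) + 2 * e)"
      by (simp add: mult_ac flip: c_t[OF ij])
    finally show "ennreal (c i j * (dist (x i) (x j) + 2 * e)) * emeasure (M \<Otimes>\<^sub>M N) (A i \<times> A j) =
        ennreal (t i j * (dist (x i) (x j) + 2 * e))" .
  qed
  also have "\<dots> = ennreal (\<Sum>i\<in>K. \<Sum>j\<in>K. t i j * (dist (x i) (x j) + 2 * e))"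
    using t \<open>0 \<le> e\<close> by (simp add: sum_ennreal sum_nonneg)
  finally have cost: "wasserstein1 M1 N1 \<le> \<dots>" .
  have "gen_wasserstein 1 1 M N \<le>
      ennreal 1 * (total_variation (\<lambda>B. measure M B - measure M1 B) + total_variation (\<lambda>B. measure N B - measure N1 B))
      + ennreal 1 * wasserstein1 M1 N1"
    unfolding gen_wasserstein_def by (rule INF_lower2[of "(M1, N1)"]) (auto simp: M1_fin N1_fin total)
  also have "\<dots> \<le> ennreal (measure M (- (\<Union>k\<in>K. A k)) + measure N (- (\<Union>k\<in>K. A k)) + (\<Sum>i\<in>K. u i) + (\<Sum>j\<in>K. v j))
      + ennreal (\<Sum>i\<in>K. \<Sum>j\<in>K. t i j * (dist (x i) (x j) + 2 * e))"
    using add_mono[OF tv cost] by simp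
  also have "\<dots> = ennreal (measure M (- (\<Union>k\<in>K. A k)) + measure N (- (\<Union>k\<in>K. A k)) + (\<Sum>i\<in>K. u i) + (\<Sum>j\<in>K. v j)
      + (\<Sum>i\<in>K. \<Sum>j\<in>K. t i j * (dist (x i) (x j) + 2 * e)))"
    using t u v \<open>0 \<le> e\<close> by (intro ennreal_plus[symmetric]) (auto intro!: sum_nonneg add_nonneg_nonneg)
  finally show ?thesis .
qed

section \<open>Duality for positive measures\<close>

text \<open>Every pair of discrete potentials interpolates to a test function, so \<open>S\<close>
  bounds the discrete dual problem up to a multiple of \<open>e\<close>. Linear programming then
  provides a plan of nearly this cost.\<close>

lemma gen_wasserstein_le_dual:
  fixes M N :: "'a::euclidean_space measure"
  assumes M: "M \<in> finite_borel_measures" and N: "N \<in> finite_borel_measures"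
    and S: "\<And>\<phi>. \<phi> \<in> lipschitz_unit_ball \<Longrightarrow> (\<integral>x. \<phi> x \<partial>M) - (\<integral>x. \<phi> x \<partial>N) \<le> S"
  shows "gen_wasserstein 1 1 M N \<le> ennreal S"
proof (rule ennreal_le_epsilon)
  fix \<delta> :: real assume "0 < \<delta>"
  have "0 \<le> S"
    using S[of "\<lambda>_. 0"] by (simp add: lipschitz_unit_ball_def lipschitz_on_def)
  \<comment> \<open>Error budget in units of \<open>e\<close>: the masses of \<open>M\<close> and
    \<open>N\<close> once each for the variation of \<open>h\<close> on the cells, the mass of
    \<open>M\<close> twice more for the cell diameters in the plan, and 4 for the two remainders,
    each counted in the dual and in the primal estimate.\<close>
  define C where "C = 3 * measure M UNIV + measure N UNIV + 4"
  have "0 < C" by (simp add: C_def add_nonneg_pos)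
  define e where "e = \<delta> / C"
  have "0 < e" using \<open>0 < C\<close> \<open>0 < \<delta>\<close> by (simp add: e_def)
  obtain A :: "nat \<Rightarrow> 'a set" and x k where A[measurable]: "\<And>i. A i \<in> sets borel" and "disjoint_family A"
    and diam: "\<And>i y. y \<in> A i \<Longrightarrow> dist y (x i) \<le> e"
    and restM: "measure M (- (\<Union>i<k. A i)) \<le> e" and restN: "measure N (- (\<Union>i<k. A i)) \<le> e"
    using small_cells[OF M N \<open>0 < e\<close>] by metis
  define K where "K = {..<k}"
  have [simp]: "finite K" by (simp add: K_def)
  have disj: "disjoint_family_on A K"
    using \<open>disjoint_family A\<close> by (auto simp: disjoint_family_on_def)
  have cells: "(\<Sum>i\<in>K. measure L (A i)) \<le> measure L UNIV" if L: "L \<in> finite_borel_measures" for L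
  proof -
    note L = finite_borel_measuresD[OF L]
    interpret L: finite_measure L by (rule L)
    have "(\<Sum>i\<in>K. measure L (A i)) = measure L (\<Union>i\<in>K. A i)"
      using disj by (intro L.finite_measure_finite_Union[symmetric]) (auto simp: L)
    also have "\<dots> \<le> measure L UNIV"
      using L.bounded_measure by (simp add: L)
    finally show ?thesis .
  qed
  let ?D = "S + e * (measure M UNIV + measure N UNIV) + 2 * e"
  obtain t u v where
    t: "\<And>i j. i \<in> K \<Longrightarrow> j \<in> K \<Longrightarrow> 0 \<le> t i j" and u: "\<And>i. i \<in> K \<Longrightarrow> 0 \<le> u i" and v: "\<And>j. j \<in> K \<Longrightarrow> 0 \<le> v j"
    and m: "\<And>i. i \<in> K \<Longrightarrow> measure M (A i) = u i + (\<Sum>j\<in>K. t i j)"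
    and n: "\<And>j. j \<in> K \<Longrightarrow> measure N (A j) = v j + (\<Sum>i\<in>K. t i j)"
    and cost: "(\<Sum>i\<in>K. u i) + (\<Sum>j\<in>K. v j) + (\<Sum>i\<in>K. \<Sum>j\<in>K. t i j * dist (x i) (x j)) \<le> ?D"
  proof (rule partial_transport_duality[of K "\<lambda>i. measure M (A i)" "\<lambda>i. measure N (A i)" "\<lambda>i j. dist (x i) (x j)" ?D])
    fix f g :: "nat \<Rightarrow> real"
    assume f: "\<And>i. i \<in> K \<Longrightarrow> f i \<le> 1" and g: "\<And>j. j \<in> K \<Longrightarrow> - 1 \<le> g j"
      and fg: "\<And>i j. i \<in> K \<Longrightarrow> j \<in> K \<Longrightarrow> f i - g j \<le> dist (x i) (x j)"
    obtain h where h: "h \<in> lipschitz_unit_ball" and hg: "\<And>j. j \<in> K \<Longrightarrow> h (x j) \<le> g j"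
      and hf: "\<And>y c. c \<le> 1 \<Longrightarrow> (\<And>j. j \<in> K \<Longrightarrow> c - g j \<le> dist y (x j)) \<Longrightarrow> c \<le> h y"
      by (rule lipschitz_interpolation[of K g x]) (simp_all add: g)
    have lip: "\<bar>h y - h z\<bar> \<le> dist y z" and bound: "\<bar>h y\<bar> \<le> 1" for y z
      using h lipschitz_onD[of 1 UNIV h y z] by (auto simp: lipschitz_unit_ball_def dist_real_def)
    note [measurable] = lipschitz_unit_ball_measurable[OF h]
    have near: "\<bar>h y - h (x i)\<bar> \<le> e" if "y \<in> A i" for y i
      using lip[of y "x i"] diam[OF that] by simp
    have "f i - e \<le> h y" if "i \<in> K" "y \<in> A i" for i y
    proof -
      have "f i \<le> h (x i)"
        by (rule hf) (use f fg that(1) in auto)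
      then show ?thesis using near[OF that(2)] by linarith
    qed
    then have "(\<Sum>i\<in>K. measure M (A i) * (f i - e)) - measure M (- (\<Union>i\<in>K. A i)) \<le> (\<integral>y. h y \<partial>M)"
      by (intro cells_le_integral[OF M _ A disj]) (auto simp: bound)
    \<comment> \<open>The same lower estimate applied to \<open>- h\<close> bounds the integral of
      \<open>h\<close> against \<open>N\<close> from above.\<close>
    moreover have "- g j - e \<le> - h y" if "j \<in> K" "y \<in> A j" for j y
      using near[OF that(2)] hg[OF that(1)] by linarith
    then have "(\<Sum>j\<in>K. measure N (A j) * (- g j - e)) - measure N (- (\<Union>i\<in>K. A i)) \<le> (\<integral>y. - h y \<partial>N)"
      by (intro cells_le_integral[OF N _ A disj]) (auto simp: bound)
    moreover have "(\<Sum>i\<in>K. measure M (A i) * (f i - e)) = (\<Sum>i\<in>K. measure M (A i) * f i) - e * (\<Sum>i\<in>K. measure M (A i))"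
      "(\<Sum>j\<in>K. measure N (A j) * (- g j - e)) = - (\<Sum>j\<in>K. measure N (A j) * g j) - e * (\<Sum>j\<in>K. measure N (A j))"
      by (simp_all add: algebra_simps sum_subtractf sum_distrib_left sum_negf sum.distrib)
    moreover have "e * (\<Sum>i\<in>K. measure M (A i)) \<le> e * measure M UNIV" "e * (\<Sum>j\<in>K. measure N (A j)) \<le> e * measure N UNIV"
      using cells[OF M] cells[OF N] \<open>0 < e\<close> by auto
    ultimately show "(\<Sum>i\<in>K. measure M (A i) * f i) - (\<Sum>j\<in>K. measure N (A j) * g j) \<le> ?D"
      using S[OF h] restM restN by (simp add: K_def distrib_left)
  qed auto
  \<comment> \<open>The transported mass is at most that of \<open>M\<close>, which controls the
    \<open>2 * e\<close> term of the plan.\<close>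
  have "(\<Sum>i\<in>K. \<Sum>j\<in>K. t i j) \<le> (\<Sum>i\<in>K. measure M (A i))"
    using m u by (intro sum_mono) simp
  then have "e * (\<Sum>i\<in>K. \<Sum>j\<in>K. t i j) \<le> e * measure M UNIV"
    using cells[OF M] \<open>0 < e\<close> by (intro mult_left_mono) auto
  moreover have "(\<Sum>i\<in>K. \<Sum>j\<in>K. t i j * (dist (x i) (x j) + 2 * e)) =
      (\<Sum>i\<in>K. \<Sum>j\<in>K. t i j * dist (x i) (x j)) + 2 * (e * (\<Sum>i\<in>K. \<Sum>j\<in>K. t i j))"
    by (simp add: distrib_left sum.distrib sum_distrib_left mult_ac)
  moreover have "e * C = \<delta>"
    using \<open>0 < C\<close> by (simp add: e_def)
  then have "e * (3 * measure M UNIV) + e * measure N UNIV + 4 * e = \<delta>"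
    by (simp add: C_def distrib_left mult_ac)
  ultimately have "measure M (- (\<Union>i\<in>K. A i)) + measure N (- (\<Union>i\<in>K. A i)) + (\<Sum>i\<in>K. u i) + (\<Sum>j\<in>K. v j)
      + (\<Sum>i\<in>K. \<Sum>j\<in>K. t i j * (dist (x i) (x j) + 2 * e)) \<le> S + \<delta>"
    using cost restM restN by (simp add: K_def distrib_left)
  moreover have "gen_wasserstein 1 1 M N \<le>
    ennreal (measure M (- (\<Union>i\<in>K. A i)) + measure N (- (\<Union>i\<in>K. A i)) + (\<Sum>i\<in>K. u i) + (\<Sum>j\<in>K. v j)
      + (\<Sum>i\<in>K. \<Sum>j\<in>K. t i j * (dist (x i) (x j) + 2 * e)))"
    using \<open>0 < e\<close> by (intro gen_wasserstein_le_plan[OF M N _ A disj diam t u v m n]) auto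
  ultimately show "gen_wasserstein 1 1 M N \<le> ennreal S + ennreal \<delta>"
    using \<open>0 \<le> S\<close> \<open>0 < \<delta>\<close> by (simp add: order_trans[OF _ ennreal_leI] flip: ennreal_plus)
qed

lemma gen_wasserstein_duality:
  fixes M N :: "'a::euclidean_space measure"
  assumes M: "M \<in> finite_borel_measures" and N: "N \<in> finite_borel_measures"
  shows "enn2ereal (gen_wasserstein 1 1 M N) =
    (SUP \<phi>\<in>lipschitz_unit_ball. ereal ((\<integral>x. \<phi> x \<partial>M) - (\<integral>x. \<phi> x \<partial>N)))" (is "_ = ?S")
proof (rule antisym)
  show "?S \<le> enn2ereal (gen_wasserstein 1 1 M N)"
  proof (rule SUP_least)
    fix \<phi> :: "'a \<Rightarrow> real" assume "\<phi> \<in> lipschitz_unit_ball"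
    let ?r = "(\<integral>x. \<phi> x \<partial>M) - (\<integral>x. \<phi> x \<partial>N)"
    have "ereal ?r \<le> enn2ereal (ennreal ?r)"
      by (cases "0 \<le> ?r") (auto simp: ennreal_neg zero_ennreal.rep_eq)
    also have "\<dots> \<le> enn2ereal (gen_wasserstein 1 1 M N)"
      using integral_diff_le_gen_wasserstein[OF M N \<open>\<phi> \<in> lipschitz_unit_ball\<close>]
      by (simp add: less_eq_ennreal.rep_eq)
    finally show "ereal ?r \<le> enn2ereal (gen_wasserstein 1 1 M N)" .
  qed
  have zero: "(\<lambda>_. 0) \<in> (lipschitz_unit_ball :: ('a \<Rightarrow> real) set)"
    by (simp add: lipschitz_unit_ball_def lipschitz_on_def)
  have "0 \<le> ?S"
    by (rule SUP_upper2[OF zero]) simp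
  show "enn2ereal (gen_wasserstein 1 1 M N) \<le> ?S"
  \<comment> \<open>An infinite supremum makes the bound trivial, and \<open>0 \<le> ?S\<close>
    excludes minus infinity.\<close>
  proof (cases ?S)
    case (real s)
    then have "(\<integral>x. \<phi> x \<partial>M) - (\<integral>x. \<phi> x \<partial>N) \<le> s" if "\<phi> \<in> lipschitz_unit_ball" for \<phi>
      using SUP_upper[OF that, of "\<lambda>\<phi>. ereal ((\<integral>x. \<phi> x \<partial>M) - (\<integral>x. \<phi> x \<partial>N))"] by simp
    from gen_wasserstein_le_dual[OF M N this]
    have "gen_wasserstein 1 1 M N \<le> ennreal s" .
    then show ?thesis
      using real \<open>0 \<le> ?S\<close> by (simp add: less_eq_ennreal.rep_eq)
  qed (use \<open>0 \<le> ?S\<close> in auto)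
qed

section \<open>Passage to signed measures\<close>

lemma add_measure_finite_borel:
  assumes "M \<in> finite_borel_measures" "N \<in> finite_borel_measures"
  shows "add_measure M N \<in> finite_borel_measures"
    and "measure (add_measure M N) A = measure M A + measure N A"
proof -
  note M = finite_borel_measuresD[OF assms(1)] and N = finite_borel_measuresD[OF assms(2)]
  interpret M: finite_measure M by (rule M)
  interpret N: finite_measure N by (rule N)
  have eq: "emeasure (add_measure M N) B = ennreal (measure M B + measure N B)" if "B \<in> sets borel" for B
    using that by (simp add: emeasure_add_measure M N M.emeasure_eq_measure N.emeasure_eq_measure)
  show "add_measure M N \<in> finite_borel_measures"
    using eq[of UNIV] by (auto simp: finite_borel_measures_def M intro!: finite_measureI)
  show "measure (add_measure M N) A = measure M A + measure N A"
    \<comment> \<open>Off the Borel sets all three values are 0, so the identity holds for every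
      set, as the equality of set functions in \<open>is_decomposition\<close> demands.\<close>
    using eq[of A]
    by (cases "A \<in> sets borel") (auto intro!: measure_eq_emeasure_eq_ennreal simp: measure_notin_sets M N)
qed

theorem proposition23:
  fixes \<mu> \<nu> :: "'a::euclidean_space set \<Rightarrow> real"
  assumes "\<mu> \<in> signed_measures" and "\<nu> \<in> signed_measures"
  shows "enn2ereal (signed_gen_wasserstein 1 1 \<mu> \<nu>) =
    (SUP \<phi>\<in>{\<phi> \<in> bounded_lipschitz_functions. sup_norm \<phi> \<le> 1 \<and> lip_norm \<phi> \<le> 1}.
       ereal (signed_integral (\<lambda>A. \<mu> A - \<nu> A) \<phi>))"
proof -
  let ?S = "SUP \<phi>\<in>lipschitz_unit_ball. ereal (signed_integral (\<lambda>A. \<mu> A - \<nu> A) \<phi>)"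
  \<comment> \<open>The right-hand side depends only on \<mu> and \<nu>, so this also proves
    independence of the decompositions, which the definite description below requires.\<close>
  have dual: "enn2ereal (gen_wasserstein 1 1 (add_measure \<mu>p \<nu>n) (add_measure \<mu>n \<nu>p)) = ?S"
    if \<mu>: "is_decomposition \<mu> \<mu>p \<mu>n" and \<nu>: "is_decomposition \<nu> \<nu>p \<nu>n" for \<mu>p \<mu>n \<nu>p \<nu>n
  proof -
    have fin: "\<mu>p \<in> finite_borel_measures" "\<mu>n \<in> finite_borel_measures"
      "\<nu>p \<in> finite_borel_measures" "\<nu>n \<in> finite_borel_measures"
      using \<mu> \<nu> by (auto simp: is_decomposition_def)
    \<comment> \<open>Regrouping the four parts by sign: the two arguments of the distance decompose
      the difference.\<close>
    have "is_decomposition (\<lambda>A. \<mu> A - \<nu> A) (add_measure \<mu>p \<nu>n) (add_measure \<mu>n \<nu>p)"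
      using \<mu> \<nu> by (auto simp: is_decomposition_def add_measure_finite_borel)
    then have "signed_integral (\<lambda>A. \<mu> A - \<nu> A) \<phi> =
        (\<integral>x. \<phi> x \<partial>add_measure \<mu>p \<nu>n) - (\<integral>x. \<phi> x \<partial>add_measure \<mu>n \<nu>p)"
      if "\<phi> \<in> lipschitz_unit_ball" for \<phi>
      using that by (intro signed_integral_eq lipschitz_unit_ball_measurable)
        (auto simp: lipschitz_unit_ball_def bounded_iff)
    then show ?thesis
      by (simp add: gen_wasserstein_duality add_measure_finite_borel fin cong: SUP_cong)
  qed
  obtain \<mu>p \<mu>n \<nu>p \<nu>n where d: "is_decomposition \<mu> \<mu>p \<mu>n" "is_decomposition \<nu> \<nu>p \<nu>n"
    using assms by (auto simp: signed_measures_def)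
  have "signed_gen_wasserstein 1 1 \<mu> \<nu> = gen_wasserstein 1 1 (add_measure \<mu>p \<nu>n) (add_measure \<mu>n \<nu>p)"
    unfolding signed_gen_wasserstein_def
  proof (rule the_equality)
    fix r assume "\<exists>\<mu>p \<mu>n \<nu>p \<nu>n. is_decomposition \<mu> \<mu>p \<mu>n \<and> is_decomposition \<nu> \<nu>p \<nu>n \<and>
      r = gen_wasserstein 1 1 (add_measure \<mu>p \<nu>n) (add_measure \<mu>n \<nu>p)"
    then have "enn2ereal r = ?S" using dual by blast
    then show "r = gen_wasserstein 1 1 (add_measure \<mu>p \<nu>n) (add_measure \<mu>n \<nu>p)"
      by (simp add: dual[OF d] enn2ereal_inject[symmetric])
  qed (use d in blast)
  then show ?thesis
    by (simp add: dual[OF d] lipschitz_unit_ball_eq)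
qed

end
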